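(* Let $G=GL_2(\mathbb{R})\ltimes\mathbb{R}^2$, let $L$ be one of the two subgroups $L(B',1)$, $L(D,1)$ of $G$, and let $H$ be a non-compact connected closed subgroup of $G$. If $L\pitchfork H$ in $G$, then $L=L(D,1)$ and $H\sim N$ in $G$.
   Context: For subsets $L,H$ of a locally compact group $G$ and $C\subset G$ write $CHC^{-1}=\{chd^{-1}: c,d\in C,\ h\in H\}$. One writes $L\pitchfork H$ in $G$ (the pair is proper) if $L\cap CHC^{-1}$ is relatively compact for every compact subset $C\subset G$, and $L\sim H$ in $G$ if there is a compact subset $C\subset G$ with $L\subset CHC^{-1}$ and $H\subset CLC^{-1}$. The group $GL_2(\mathbb{R})\ltimes\mathbb{R}^2$ is realized as the matrices $\begin{pmatrix} g & v \\ 0 & 1\end{pmatrix}\in GL_3(\mathbb{R})$ with $g\in GL_2(\mathbb{R})$, $v\in\mathbb{R}^2$; such an element is abbreviated by the $2\times 3$ matrix $(g\ v)$. The subgroups are $$L(B',1)=\left\{\begin{pmatrix}e^t & 0 & 0 \\ s & e^t & u\end{pmatrix}:s,t,u\in\mathbb{R}\right\},\quad L(D,1)=\left\{\begin{pmatrix}e^{t+s} & 0 & 0 \\ 0 & e^{t-s} & u\end{pmatrix}:s,t,u\in\mathbb{R}\right\},$$ $$N=\left\{\begin{pmatrix}1 & 0 & t \\ t & 1 & \frac12t^2\end{pmatrix}:t\in\mathbb{R}\right\}.$$ *)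

theory Defs
  imports "HOL-Analysis.Analysis" "HOL-Algebra.Group"
begin

text \<open>In the next three definitions \<open>G\<close> is a group and \<open>T\<close> a topology on \<open>carrier G\<close>.\<close>

definition translates :: "('a, 'b) monoid_scheme \<Rightarrow> 'a set \<Rightarrow> 'a set \<Rightarrow> 'a set" where
  "translates G C H = {c \<otimes>\<^bsub>G\<^esub> h \<otimes>\<^bsub>G\<^esub> inv\<^bsub>G\<^esub> d | c h d. c \<in> C \<and> h \<in> H \<and> d \<in> C}"

definition proper_pair :: "('a, 'b) monoid_scheme \<Rightarrow> 'a topology \<Rightarrow> 'a set \<Rightarrow> 'a set \<Rightarrow> bool" where
  "proper_pair G T L H \<longleftrightarrow>
     (\<forall>C. compactin T C \<longrightarrow> compactin T (T closure_of (L \<inter> translates G C H)))"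

definition similar_pair :: "('a, 'b) monoid_scheme \<Rightarrow> 'a topology \<Rightarrow> 'a set \<Rightarrow> 'a set \<Rightarrow> bool" where
  "similar_pair G T L H \<longleftrightarrow>
     (\<exists>C. compactin T C \<and> L \<subseteq> translates G C H \<and> H \<subseteq> translates G C L)"

definition aff_mat :: "real^2^2 \<Rightarrow> real^2 \<Rightarrow> real^3^3" where
  "aff_mat g v = vector [vector [g$1$1, g$1$2, v$1],
                         vector [g$2$1, g$2$2, v$2],
                         vector [0,     0,     1]]"

definition aff_group :: "(real^3^3) monoid" where
  "aff_group = \<lparr>carrier = {aff_mat g v | g v. invertible g}, mult = (**), one = mat 1\<rparr>"

text \<open>Relative to \<open>aff_top\<close>, closedness and closures are taken inside the group, which is not
  closed in the space of all matrices.\<close>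

definition aff_top :: "(real^3^3) topology" where
  "aff_top = top_of_set (carrier aff_group)"

definition L_B1 :: "(real^3^3) set" where
  "L_B1 = {aff_mat (vector [vector [exp t, 0], vector [s, exp t]]) (vector [0, u]) | s t u. True}"

definition L_D1 :: "(real^3^3) set" where
  "L_D1 = {aff_mat (vector [vector [exp (t + s), 0], vector [0, exp (t - s)]]) (vector [0, u])
           | s t u. True}"

definition N_parab :: "(real^3^3) set" where
  "N_parab = {aff_mat (vector [vector [1, 0], vector [t, 1]]) (vector [t, t\<^sup>2 / 2]) | t. True}"

lemma aff_mat_mult: "aff_mat g v ** aff_mat h w = aff_mat (g ** h) (g *v w + v)"
  by (simp add: aff_mat_def vec_eq_iff forall_3 forall_2 matrix_matrix_mult_def
      matrix_vector_mult_def sum_3 sum_2)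

lemma aff_mat_one: "aff_mat (mat 1) 0 = mat 1"
  by (simp add: aff_mat_def vec_eq_iff forall_3 mat_def)

lemma aff_mat_in_carrier: "invertible g \<Longrightarrow> aff_mat g v \<in> carrier aff_group"
  by (auto simp: aff_group_def)

lemma group_aff_group: "group aff_group"
proof (rule groupI)
  fix x y assume "x \<in> carrier aff_group" "y \<in> carrier aff_group"
  then obtain g v h w where xy: "x = aff_mat g v" "y = aff_mat h w"
    and "invertible g" "invertible h"
    by (auto simp: aff_group_def)
  then have "aff_mat (g ** h) (g *v w + v) \<in> carrier aff_group"
    by (intro aff_mat_in_carrier invertible_mult)
  then show "x \<otimes>\<^bsub>aff_group\<^esub> y \<in> carrier aff_group"
    by (simp add: xy aff_group_def aff_mat_mult)
next
  have "invertible (mat 1 :: real^2^2)"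
    by (auto simp: invertible_def intro!: exI[of _ "mat 1"])
  from aff_mat_in_carrier[OF this, of 0]
  show "\<one>\<^bsub>aff_group\<^esub> \<in> carrier aff_group"
    by (simp add: aff_mat_one) (simp add: aff_group_def)
next
  fix x assume "x \<in> carrier aff_group"
  then obtain g v where x: "x = aff_mat g v" and g: "invertible g"
    by (auto simp: aff_group_def)
  then obtain h where h: "h ** g = mat 1" "g ** h = mat 1"
    by (auto simp: invertible_def)
  have "aff_mat h (- (h *v v)) ** x = mat 1"
    by (simp add: x aff_mat_mult h aff_mat_one)
  then have "aff_mat h (- (h *v v)) \<otimes>\<^bsub>aff_group\<^esub> x = \<one>\<^bsub>aff_group\<^esub>"
    by (simp add: aff_group_def)
  moreover have "invertible h" using h by (auto simp: invertible_def)
  ultimately show "\<exists>y\<in>carrier aff_group. y \<otimes>\<^bsub>aff_group\<^esub> x = \<one>\<^bsub>aff_group\<^esub>"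
    using aff_mat_in_carrier by blast
qed (auto simp: aff_group_def matrix_mul_assoc)

end

theory Submission imports Defs begin

text \<open>
  Why the theorem holds. Properness of \<open>(L, H)\<close> says that, for each compact \<open>C\<close>, the elements of
  \<open>H\<close> that \<open>C\<close> moves into \<open>L\<close> from both sides form a bounded set (\<open>thin\<close>). This is strong
  because \<open>L\<close>, thickened by a compact set, is large. Orthogonal maps on both sides bring every
  linear map into \<open>L\<close>
  (\<open>near_linear\<close>), hence also, after a bounded translation, every affine map with a fixed point in
  a bounded region (\<open>near_fixed_point\<close>); and a rotation brings every translation into \<open>L\<close>, hence
  every map with bounded linear part is near \<open>L\<close> (\<open>near_bounded_linear_part\<close>).

  Apply this to the iterated squares of one element \<open>h\<close> of \<open>H\<close>. If \<open>h\<close> has a fixed point, the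
  squares are bounded, so the linear part of \<open>h\<close> has determinant \<open>1\<close> and trace in \<open>[-2, 2]\<close>; the
  sign of the determinant is fixed because \<open>H\<close> is connected. If \<open>h\<close> has no fixed point, its linear
  part has the eigenvalue \<open>1\<close>; were the other eigenvalue different from \<open>1\<close>, the squares of \<open>h\<close> or
  of its inverse would again stay near \<open>L\<close> while their determinants grow
  (\<open>no_eigenvalue_1_expanding\<close>). So the linear parts form a subgroup of \<open>SL\<^sub>2\<close> with all traces in
  \<open>[-2, 2]\<close>.

  An elliptic linear part forces all others to commute with it, because the commutator of an
  elliptic element with anything has trace at least \<open>2\<close>, with equality only if the two commute. Then
  the linear parts are bounded, and so is \<open>H\<close> (\<open>elliptic_imp_bounded\<close>), contrary to
  non-compactness. Hence \<open>H\<close> contains an element with parabolic linear part. It cannot have a fixed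
  point, so it is conjugate to the element of \<open>N_parab\<close> with parameter \<open>1\<close>
  (\<open>parabolic_conj_screw\<close>), and \<open>H\<close> may be replaced by a conjugate that contains this element. The
  trace bound together with connectedness makes all linear parts lower unipotent. A translation in
  \<open>H\<close> is trivial, so an element is determined by its linear part; thus \<open>H\<close> is commutative, and
  commuting with one element of \<open>N_parab\<close> and dividing it by powers of two determines \<open>H\<close> on a
  dense set. Since \<open>H\<close> is closed, \<open>H = N_parab\<close> (\<open>contains_screw_imp_eq_N_parab\<close>).

  Finally, \<open>N_parab\<close> lies near \<open>L_B1\<close> (\<open>screw_near_L_B1\<close>) and is unbounded, so \<open>L\<close> must be \<open>L_D1\<close>.
\<close>

section \<open>Coordinates on the affine group\<close>

text \<open>Written in six real coordinates, products and inverses in the group become polynomial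
  identities.\<close>

definition aff :: "real \<Rightarrow> real \<Rightarrow> real \<Rightarrow> real \<Rightarrow> real \<Rightarrow> real \<Rightarrow> real^3^3" where
  "aff a b c d p q = aff_mat (vector [vector [a, b], vector [c, d]]) (vector [p, q])"

definition lin_det :: "real^3^3 \<Rightarrow> real" where
  "lin_det h = h$1$1 * h$2$2 - h$1$2 * h$2$1"

definition lin_tr :: "real^3^3 \<Rightarrow> real" where
  "lin_tr h = h$1$1 + h$2$2"

lemma aff_nth [simp]:
  "aff a b c d p q $1$1 = a" "aff a b c d p q $1$2 = b" "aff a b c d p q $1$3 = p"
  "aff a b c d p q $2$1 = c" "aff a b c d p q $2$2 = d" "aff a b c d p q $2$3 = q"
  "aff a b c d p q $3$1 = 0" "aff a b c d p q $3$2 = 0" "aff a b c d p q $3$3 = 1"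
  by (simp_all add: aff_def aff_mat_def)

lemma aff_eq_iff [simp]:
  "aff a b c d p q = aff a' b' c' d' p' q' \<longleftrightarrow>
   a = a' \<and> b = b' \<and> c = c' \<and> d = d' \<and> p = p' \<and> q = q'"
  by (metis aff_nth)

lemma lin_det_aff [simp]: "lin_det (aff a b c d p q) = a * d - b * c"
  by (simp add: lin_det_def)

lemma lin_tr_aff [simp]: "lin_tr (aff a b c d p q) = a + d"
  by (simp add: lin_tr_def)

lemma aff_mult:
  "aff a b c d p q ** aff a' b' c' d' p' q' =
   aff (a*a' + b*c') (a*b' + b*d') (c*a' + d*c') (c*b' + d*d')
       (a*p' + b*q' + p) (c*p' + d*q' + q)"
  by (simp add: vec_eq_iff forall_3 matrix_matrix_mult_def sum_3)

lemma aff_one: "mat 1 = aff 1 0 0 1 0 0"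
  by (simp add: vec_eq_iff forall_3 mat_def)

lemma carrier_iff_aff:
  "h \<in> carrier aff_group \<longleftrightarrow> (\<exists>a b c d p q. h = aff a b c d p q \<and> a * d - b * c \<noteq> 0)"
proof
  assume "h \<in> carrier aff_group"
  then obtain g v where h: "h = aff_mat g v" and g: "invertible g"
    by (auto simp: aff_group_def)
  have "h = aff (g$1$1) (g$1$2) (g$2$1) (g$2$2) (v$1) (v$2)"
    by (simp add: h aff_def aff_mat_def)
  moreover have "g$1$1 * g$2$2 - g$1$2 * g$2$1 \<noteq> 0"
    using g by (simp add: invertible_det_nz det_2)
  ultimately show "\<exists>a b c d p q. h = aff a b c d p q \<and> a * d - b * c \<noteq> 0" by blast
next
  assume "\<exists>a b c d p q. h = aff a b c d p q \<and> a * d - b * c \<noteq> 0"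
  then show "h \<in> carrier aff_group"
    by (auto simp: aff_def invertible_det_nz det_2 intro!: aff_mat_in_carrier)
qed

lemma aff_in_carrier [simp]: "aff a b c d p q \<in> carrier aff_group \<longleftrightarrow> a * d - b * c \<noteq> 0"
  by (auto simp: carrier_iff_aff)

lemma carrier_iff_entries:
  "h \<in> carrier aff_group \<longleftrightarrow> h$3$1 = 0 \<and> h$3$2 = 0 \<and> h$3$3 = 1 \<and> lin_det h \<noteq> 0"
proof
  assume *: "h$3$1 = 0 \<and> h$3$2 = 0 \<and> h$3$3 = 1 \<and> lin_det h \<noteq> 0"
  then have "h = aff (h$1$1) (h$1$2) (h$2$1) (h$2$2) (h$1$3) (h$2$3)"
    by (simp add: vec_eq_iff forall_3)
  with * show "h \<in> carrier aff_group" by (metis aff_in_carrier lin_det_def)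
qed (auto simp: carrier_iff_aff)

lemma mult_aff_group [simp]: "x \<otimes>\<^bsub>aff_group\<^esub> y = x ** y"
  by (simp add: aff_group_def)

lemma one_aff_group [simp]: "\<one>\<^bsub>aff_group\<^esub> = mat 1"
  by (simp add: aff_group_def)

lemma lin_det_mult:
  assumes "g \<in> carrier aff_group" "h \<in> carrier aff_group"
  shows "lin_det (g ** h) = lin_det g * lin_det h"
  using assms by (auto simp: carrier_iff_aff aff_mult algebra_simps)

lemma carrier_mult:
  assumes "g \<in> carrier aff_group" "h \<in> carrier aff_group"
  shows "g ** h \<in> carrier aff_group"
  using group.is_monoid[OF group_aff_group, THEN monoid.m_closed, OF assms] by simp

lemma inv_carrier:
  assumes "g \<in> carrier aff_group"
  shows "inv\<^bsub>aff_group\<^esub> g \<in> carrier aff_group"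
        "inv\<^bsub>aff_group\<^esub> g ** g = mat 1" "g ** inv\<^bsub>aff_group\<^esub> g = mat 1"
  using group.inv_closed[OF group_aff_group assms] group.l_inv[OF group_aff_group assms]
    group.r_inv[OF group_aff_group assms] by auto

lemma inv_aff:
  assumes "a * d - b * c \<noteq> 0"
  defines "D \<equiv> a * d - b * c"
  shows "inv\<^bsub>aff_group\<^esub> (aff a b c d p q) =
    aff (d/D) (-b/D) (-c/D) (a/D) ((b*q - d*p)/D) ((c*p - a*q)/D)" (is "_ = ?g")
proof -
  have D: "D \<noteq> 0" using assms by simp
  have "d/D * (a/D) - (-b/D) * (-c/D) = (a*d - b*c)/(D*D)" using D by (simp add: field_simps)
  then have g: "?g \<in> carrier aff_group" using D by (simp add: D_def)
  have "?g ** aff a b c d p q = mat 1"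
    unfolding aff_mult aff_one aff_eq_iff
    using D by (simp add: divide_simps) (simp add: D_def algebra_simps)
  then show ?thesis
    using group.inv_equality[OF group_aff_group, of ?g "aff a b c d p q"] g assms by simp
qed

section \<open>A compact exhaustion of the group\<close>

text \<open>The lower bound on the determinant keeps a box away from the singular matrices, so that boxes
  are compact in the group and not only bounded in the space of matrices.\<close>

definition aff_box :: "real \<Rightarrow> (real^3^3) set" where
  "aff_box R = {h \<in> carrier aff_group. (\<forall>i j. \<bar>h$i$j\<bar> \<le> R) \<and> 1 \<le> R * \<bar>lin_det h\<bar>}"

lemma aff_in_aff_box:
  assumes "1 \<le> R"
  shows "aff a b c d p q \<in> aff_box R \<longleftrightarrow>
     \<bar>a\<bar> \<le> R \<and> \<bar>b\<bar> \<le> R \<and> \<bar>c\<bar> \<le> R \<and> \<bar>d\<bar> \<le> R \<and> \<bar>p\<bar> \<le> R \<and> \<bar>q\<bar> \<le> R \<and> 1 \<le> R * \<bar>a * d - b * c\<bar>"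
  using assms by (auto simp: aff_box_def forall_3)

lemma aff_box_carrier: "h \<in> aff_box R \<Longrightarrow> h \<in> carrier aff_group"
  by (simp add: aff_box_def)

lemma aff_box_ge_1: "h \<in> aff_box R \<Longrightarrow> 1 \<le> R"
  by (auto simp: aff_box_def carrier_iff_entries dest!: spec[of _ 3])

lemma aff_box_mono:
  assumes "h \<in> aff_box R" "R \<le> S"
  shows "h \<in> aff_box S"
proof -
  have "R * \<bar>lin_det h\<bar> \<le> S * \<bar>lin_det h\<bar>" using assms by (intro mult_right_mono) auto
  with assms show ?thesis unfolding aff_box_def by (auto intro: order_trans)
qed

lemma aff_box_mult:
  assumes g: "g \<in> aff_box R" and h: "h \<in> aff_box S"
  shows "g ** h \<in> aff_box (3 * R * S)"
proof -
  have R: "1 \<le> R" "1 \<le> S" using assms aff_box_ge_1 by auto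
  have RS: "1 * 1 \<le> R * S" "R * 1 \<le> R * S" using R by (intro mult_mono; simp)+
  obtain a b c d p q where g': "g = aff a b c d p q" using aff_box_carrier[OF g] carrier_iff_aff by auto
  obtain a' b' c' d' p' q' where h': "h = aff a' b' c' d' p' q'"
    using aff_box_carrier[OF h] carrier_iff_aff by auto
  have prod: "\<bar>x * y\<bar> \<le> R * S" if "\<bar>x\<bar> \<le> R" "\<bar>y\<bar> \<le> S" for x y
    unfolding abs_mult using that R by (intro mult_mono) auto
  note G = g[unfolded g' aff_in_aff_box[OF R(1)]]
  note H = h[unfolded h' aff_in_aff_box[OF R(2)]]
  have "1 * 1 \<le> (R * \<bar>a * d - b * c\<bar>) * (S * \<bar>a' * d' - b' * c'\<bar>)"
    using G H by (intro mult_mono) auto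
  also have "\<dots> = R * S * \<bar>lin_det (g ** h)\<bar>"
    using lin_det_mult[OF aff_box_carrier[OF g] aff_box_carrier[OF h]] by (simp add: g' h' abs_mult)
  also have "\<dots> \<le> 3 * R * S * \<bar>lin_det (g ** h)\<bar>"
    using R by (intro mult_right_mono) auto
  finally have det: "1 \<le> 3 * R * S * \<bar>lin_det (g ** h)\<bar>" by simp
  have sum2: "\<bar>x * y + z * w\<bar> \<le> 3 * R * S" if "\<bar>x\<bar> \<le> R" "\<bar>y\<bar> \<le> S" "\<bar>z\<bar> \<le> R" "\<bar>w\<bar> \<le> S" for x y z w
    using prod[OF that(1,2)] prod[OF that(3,4)] RS by linarith
  have sum3: "\<bar>x * y + z * w + u\<bar> \<le> 3 * R * S"
    if "\<bar>x\<bar> \<le> R" "\<bar>y\<bar> \<le> S" "\<bar>z\<bar> \<le> R" "\<bar>w\<bar> \<le> S" "\<bar>u\<bar> \<le> R" for x y z w u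
    using prod[OF that(1,2)] prod[OF that(3,4)] that(5) RS by linarith
  have "1 \<le> 3 * R * S" using RS by linarith
  then show ?thesis
    unfolding g' h' aff_mult using det G H
    by (subst aff_in_aff_box) (auto intro!: sum2 sum3 simp: g' h' aff_mult)
qed

lemma aff_box_inv:
  assumes g: "g \<in> aff_box R"
  shows "inv\<^bsub>aff_group\<^esub> g \<in> aff_box (2 * R^3)"
proof -
  have R: "1 \<le> R" using assms aff_box_ge_1 by auto
  obtain a b c d p q where g': "g = aff a b c d p q" and D0: "a * d - b * c \<noteq> 0"
    using aff_box_carrier[OF g] carrier_iff_aff by auto
  define D where "D = a * d - b * c"
  note G = g[unfolded g' aff_in_aff_box[OF R(1)], folded D_def]
  have D: "D \<noteq> 0" using D0 D_def by simp
  have prod: "\<bar>x * y\<bar> \<le> R * R" if "\<bar>x\<bar> \<le> R" "\<bar>y\<bar> \<le> R" for x y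
    unfolding abs_mult using that R by (intro mult_mono) auto
  have invD: "1 / \<bar>D\<bar> \<le> R" using G D by (simp add: field_simps)
  have R2: "R * 1 \<le> R * R" using R by (intro mult_mono) auto
  have quot: "\<bar>x / D\<bar> \<le> 2 * R^3" if "\<bar>x\<bar> \<le> 2 * (R * R)" for x
  proof -
    have "\<bar>x / D\<bar> = \<bar>x\<bar> * (1 / \<bar>D\<bar>)" by (simp add: abs_divide)
    also have "\<dots> \<le> (2 * (R * R)) * R" using that invD R by (intro mult_mono) auto
    finally show ?thesis by (simp add: power3_eq_cube)
  qed
  have "\<bar>D\<bar> \<le> 2 * (R * R)"
    unfolding D_def using prod[of a d] prod[of b c] G by linarith
  also have "\<dots> * 1 \<le> 2 * (R * R) * R" using R by (intro mult_mono) auto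
  finally have Dle: "\<bar>D\<bar> \<le> 2 * R^3" by (simp add: power3_eq_cube)
  have "(d/D) * (a/D) - (-b/D) * (-c/D) = (a * d - b * c) / (D * D)"
    by (simp add: diff_divide_distrib)
  also have "\<dots> = 1 / D" using D unfolding D_def by simp
  finally have det: "(d/D) * (a/D) - (-b/D) * (-c/D) = 1 / D" .
  have e1: "\<bar>x\<bar> \<le> 2 * (R * R)" if "\<bar>x\<bar> \<le> R" for x using that R R2 by linarith
  have e2: "\<bar>x * y - z * w\<bar> \<le> 2 * (R * R)" if "\<bar>x\<bar> \<le> R" "\<bar>y\<bar> \<le> R" "\<bar>z\<bar> \<le> R" "\<bar>w\<bar> \<le> R" for x y z w
    using prod[OF that(1,2)] prod[OF that(3,4)] by linarith
  have one: "1 \<le> 2 * R^3" using power_mono[OF R, of 3] by simp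
  show ?thesis
    unfolding g' inv_aff[OF D0] D_def[symmetric] aff_in_aff_box[OF one] det
    using G Dle D by (intro conjI quot e1 e2) (auto simp: field_simps)
qed

lemma continuous_on_lin_det [continuous_intros]: "continuous_on S lin_det"
  unfolding lin_det_def by (intro continuous_intros)

lemma compact_aff_box: "compact (aff_box R)"
proof (cases "1 \<le> R")
  case False
  then have "aff_box R = {}" using aff_box_ge_1 by blast
  then show ?thesis by simp
next
  case True
  have eq: "aff_box R = {h. h$3$1 = 0} \<inter> {h. h$3$2 = 0} \<inter> {h. h$3$3 = 1} \<inter> {h. 1 \<le> R * \<bar>lin_det h\<bar>}
     \<inter> (\<Inter>i. \<Inter>j. {h. \<bar>h$i$j\<bar> \<le> R})"
    using True by (auto simp: aff_box_def carrier_iff_entries)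
  have "closed (aff_box R)"
    unfolding eq by (intro closed_Int closed_INT ballI closed_Collect_eq closed_Collect_le continuous_intros)
  moreover have "bounded (aff_box R)"
  proof (rule boundedI)
    fix h assume h: "h \<in> aff_box R"
    have "norm h \<le> (\<Sum>i\<in>UNIV. norm (h$i))" by (simp add: norm_le_l1_cart norm_vec_def L2_set_le_sum)
    also have "\<dots> \<le> (\<Sum>i\<in>(UNIV::3 set). \<Sum>j\<in>(UNIV::3 set). \<bar>h$i$j\<bar>)"
      by (intro sum_mono norm_le_l1_cart)
    also have "\<dots> \<le> (\<Sum>i\<in>(UNIV::3 set). \<Sum>j\<in>(UNIV::3 set). R)"
      using h by (intro sum_mono) (auto simp: aff_box_def)
    finally show "norm h \<le> (\<Sum>i\<in>(UNIV::3 set). \<Sum>j\<in>(UNIV::3 set). R)" .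
  qed
  ultimately show ?thesis by (simp add: compact_eq_bounded_closed)
qed

lemma compactin_aff_top: "compactin aff_top S \<longleftrightarrow> compact S \<and> S \<subseteq> carrier aff_group"
  by (simp add: aff_top_def compactin_subtopology)

lemma compact_subset_aff_box:
  assumes "compactin aff_top S"
  obtains R where "1 \<le> R" "S \<subseteq> aff_box R"
proof -
  have S: "compact S" "S \<subseteq> carrier aff_group" using assms by (auto simp: compactin_aff_top)
  have "continuous_on S (\<lambda>h. inverse (lin_det h))"
    using S(2) by (intro continuous_intros) (auto simp: carrier_iff_entries)
  from compact_imp_bounded[OF compact_continuous_image[OF this S(1)]]
  obtain M where M: "\<And>h. h \<in> S \<Longrightarrow> \<bar>inverse (lin_det h)\<bar> \<le> M" by (auto simp: bounded_iff)
  obtain N where N: "\<And>h. h \<in> S \<Longrightarrow> norm h \<le> N"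
    using compact_imp_bounded[OF S(1)] by (auto simp: bounded_iff)
  define R where "R = max 1 (max M N)"
  have "h \<in> aff_box R" if h: "h \<in> S" for h
  proof -
    have "\<bar>h$i$j\<bar> \<le> R" for i j
      using component_le_norm_cart[of "h$i" j] Finite_Cartesian_Product.norm_nth_le[of h i] N[OF h]
      unfolding R_def by linarith
    moreover have "inverse \<bar>lin_det h\<bar> \<le> R" using M[OF h] unfolding R_def by simp
    ultimately show ?thesis using h S(2) by (auto simp: aff_box_def carrier_iff_entries field_simps)
  qed
  then show ?thesis by (intro that[of R]) (auto simp: R_def)
qed

section \<open>Properness as boundedness\<close>

text \<open>Up to compact thickening, \<open>near L R\<close> is the two-sided neighbourhood of \<open>L\<close> from the definition
  of properness. The right-hand factor is \<open>d\<close> instead of its inverse, which makes no difference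
  because inverses of a box lie in a larger box.\<close>

definition near :: "(real^3^3) set \<Rightarrow> real \<Rightarrow> (real^3^3) set" where
  "near L R = {h \<in> carrier aff_group. \<exists>c\<in>aff_box R. \<exists>d\<in>aff_box R. c ** h ** d \<in> L}"

text \<open>A form of properness that is stable under conjugation of \<open>H\<close> and only speaks of bounds.\<close>

definition thin :: "(real^3^3) set \<Rightarrow> (real^3^3) set \<Rightarrow> bool" where
  "thin L H \<longleftrightarrow> (\<forall>R. \<exists>S. H \<inter> near L R \<subseteq> aff_box S)"

lemma near_shift:
  assumes "c \<in> aff_box R" "d \<in> aff_box R" "h \<in> carrier aff_group" "c ** h ** d \<in> near L S"
  shows "h \<in> near L (3 * R * S)"
proof -
  obtain c' d' where c': "c' \<in> aff_box S" "d' \<in> aff_box S" and L: "c' ** (c ** h ** d) ** d' \<in> L"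
    using assms(4) by (auto simp: near_def)
  have "c' ** c \<in> aff_box (3 * R * S)" using aff_box_mult[OF c'(1) assms(1)] by (simp add: mult.commute mult.left_commute)
  moreover have "d ** d' \<in> aff_box (3 * R * S)" using aff_box_mult[OF assms(2) c'(2)] .
  moreover have "(c' ** c) ** h ** (d ** d') \<in> L" using L by (simp add: matrix_mul_assoc)
  ultimately show ?thesis using assms(3) unfolding near_def by blast
qed

lemma near_mono: "h \<in> near L R \<Longrightarrow> R \<le> S \<Longrightarrow> h \<in> near L S"
  unfolding near_def using aff_box_mono by blast

lemma proper_pair_imp_thin:
  assumes pp: "proper_pair aff_group aff_top L H" and H: "H \<subseteq> carrier aff_group"
    and L: "L \<subseteq> carrier aff_group"
  shows "thin L H"
  unfolding thin_def
proof
  fix R :: real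
  have r2: "R \<le> 2 * R^3" if "1 \<le> R"
  proof -
    have "R \<le> R^3" using self_le_power[OF that, of 3] by simp
    then show ?thesis using that by simp
  qed
  define C where "C = aff_box (2 * R^3)"
  have "compactin aff_top C" unfolding C_def compactin_aff_top
    using compact_aff_box aff_box_carrier by auto
  then have "compactin aff_top (aff_top closure_of (L \<inter> translates aff_group C H))"
    using pp by (auto simp: proper_pair_def)
  then obtain S where S: "1 \<le> S" "aff_top closure_of (L \<inter> translates aff_group C H) \<subseteq> aff_box S"
    using compact_subset_aff_box by metis
  have "L \<inter> translates aff_group C H \<subseteq> aff_top closure_of (L \<inter> translates aff_group C H)"
    using L by (intro closure_of_subset) (auto simp: aff_top_def)
  with S have sub: "L \<inter> translates aff_group C H \<subseteq> aff_box S" by blast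
  have "h \<in> aff_box (3 * (3 * (2 * R^3) * S) * (2 * R^3))" if h: "h \<in> H" "h \<in> near L R" for h
  proof -
    obtain c d where c: "c \<in> aff_box R" "d \<in> aff_box R" and chd: "c ** h ** d \<in> L"
      using h by (auto simp: near_def)
    let ?i = "\<lambda>x. inv\<^bsub>aff_group\<^esub> x"
    have R1: "1 \<le> R" using aff_box_ge_1[OF c(1)] .
    note cc = aff_box_carrier[OF c(1)] and dd = aff_box_carrier[OF c(2)]
    have "c \<in> C" using c r2[OF R1] aff_box_mono by (auto simp: C_def)
    moreover have "?i d \<in> C" using aff_box_inv[OF c(2)] by (simp add: C_def)
    moreover have "?i (?i d) = d" using group.inv_inv[OF group_aff_group dd] .
    ultimately have "c ** h ** d \<in> translates aff_group C H"
      using h(1) unfolding translates_def mem_Collect_eq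
      by (intro exI[of _ c] exI[of _ h] exI[of _ "?i d"]) simp
    with chd sub have 1: "c ** h ** d \<in> aff_box S" by blast
    have "?i c ** (c ** h ** d) ** ?i d = (?i c ** c) ** h ** (d ** ?i d)"
      by (simp add: matrix_mul_assoc)
    also have "\<dots> = h" using inv_carrier[OF cc] inv_carrier[OF dd] by simp
    finally show ?thesis
      using aff_box_mult[OF aff_box_mult[OF aff_box_inv[OF c(1)] 1] aff_box_inv[OF c(2)]] by simp
  qed
  then show "\<exists>S. H \<inter> near L R \<subseteq> aff_box S" by blast
qed

section \<open>Elements near the two subgroups\<close>

lemma L_B1_eq: "L_B1 = {aff (exp t) 0 s (exp t) 0 u |s t u. True}"
  by (simp add: L_B1_def aff_def)

lemma L_D1_eq: "L_D1 = {aff (exp (t + s)) 0 0 (exp (t - s)) 0 u |s t u. True}"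
  by (simp add: L_D1_def aff_def)

lemma aff_in_L_B1: "aff a b c d p q \<in> L_B1 \<longleftrightarrow> 0 < a \<and> d = a \<and> b = 0 \<and> p = 0"
proof -
  have "\<exists>t. a = exp t" if "0 < a" using that by (metis exp_ln)
  then show ?thesis unfolding L_B1_eq by auto
qed

lemma aff_in_L_D1: "aff a b c d p q \<in> L_D1 \<longleftrightarrow> 0 < a \<and> 0 < d \<and> b = 0 \<and> c = 0 \<and> p = 0"
proof -
  have "\<exists>t s. a = exp (t + s) \<and> d = exp (t - s)" if "0 < a" "0 < d"
  proof (intro exI conjI)
    show "a = exp ((ln a + ln d)/2 + (ln a - ln d)/2)" using that by (simp flip: add_divide_distrib)
    show "d = exp ((ln a + ln d)/2 - (ln a - ln d)/2)" using that by (simp flip: diff_divide_distrib)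
  qed
  then show ?thesis unfolding L_D1_eq by auto
qed

lemma L_subset_carrier: "L_B1 \<subseteq> carrier aff_group" "L_D1 \<subseteq> carrier aff_group"
  unfolding L_B1_eq L_D1_eq by auto

lemma orthogonal_in_aff_box:
  assumes "x\<^sup>2 + y\<^sup>2 = 1" "\<bar>e\<bar> = 1"
  shows "aff (e*x) (-(e*y)) y x 0 0 \<in> aff_box 2"
proof -
  have "x\<^sup>2 \<le> 1" "y\<^sup>2 \<le> 1" using assms(1) zero_le_power2[of x] zero_le_power2[of y] by linarith+
  then have xy: "\<bar>x\<bar> \<le> 1" "\<bar>y\<bar> \<le> 1" by (simp_all add: abs_square_le_1)
  have "e*x * x - (-(e*y)) * y = e" using assms(1) by (simp add: algebra_simps power2_eq_square flip: distrib_left)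
  then show ?thesis using xy assms(2) by (subst aff_in_aff_box) (auto simp: abs_mult)
qed

lemma unit_vector:
  fixes p q :: real
  assumes "sqrt (p\<^sup>2 + q\<^sup>2) \<noteq> 0"
  shows "(q / sqrt (p\<^sup>2 + q\<^sup>2))\<^sup>2 + (p / sqrt (p\<^sup>2 + q\<^sup>2))\<^sup>2 = 1"
proof -
  have "p\<^sup>2 + q\<^sup>2 \<noteq> 0" using assms by simp
  then show ?thesis by (simp add: power_divide add.commute flip: add_divide_distrib)
qed

text \<open>Rotating a unit vector \<open>(x, y)\<close> and its image \<open>(v1, v2)\<close> to the second axis makes the matrix
  lower triangular with positive diagonal. A translation part along the image ends up on the second
  axis, which is where both subgroups \<open>L\<close> have theirs. The two ways to land in \<open>L\<close> are then a
  condition on the unit vector: equal diagonal entries for \<open>L_B1\<close>, a diagonal matrix for \<open>L_D1\<close>.\<close>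

lemma rotate_to_lower_triangular:
  fixes a b c d x y r :: real
  assumes D: "a * d - b * c \<noteq> 0" and xy: "x\<^sup>2 + y\<^sup>2 = 1"
  defines "v1 \<equiv> a*x + b*y" and "v2 \<equiv> c*x + d*y"
  defines "m \<equiv> sqrt (v1\<^sup>2 + v2\<^sup>2)"
  shows "m > 0"
    and "\<exists>k\<in>aff_box 2. \<exists>l\<in>aff_box 2. k ** aff a b c d (r* v1) (r* v2) ** l =
      aff (\<bar>a*d - b*c\<bar> / m) 0 ((v1 * (a*y - b*x) + v2 * (c*y - d*x)) / m) m 0 (r*m)"
proof -
  have det: "v2 * (a*y - b*x) - v1 * (c*y - d*x) = a*d - b*c"
  proof -
    have "v2 * (a*y - b*x) - v1 * (c*y - d*x) = (a*d - b*c) * (x\<^sup>2 + y\<^sup>2)"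
      unfolding v1_def v2_def by (simp add: algebra_simps power2_eq_square)
    then show ?thesis using xy by simp
  qed
  show m: "m > 0"
  proof -
    have "v1 \<noteq> 0 \<or> v2 \<noteq> 0" using det D by auto
    then show ?thesis unfolding m_def by (simp add: sum_power2_gt_zero_iff)
  qed
  have m2: "m * m = v1 * v1 + v2 * v2" unfolding m_def by (simp add: power2_eq_square)
  \<comment> \<open>For a negative determinant the rotation is composed with a reflection, so that the first
    diagonal entry becomes positive as well.\<close>
  define e where "e = sgn (a*d - b*c)"
  have e: "\<bar>e\<bar> = 1" using D by (simp add: e_def abs_sgn_eq)
  have eD: "e * (a*d - b*c) = \<bar>a*d - b*c\<bar>" by (simp add: e_def abs_sgn mult.commute)
  define k where "k = aff (e*(v2/m)) (-(e*(v1/m))) (v1/m) (v2/m) 0 0"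
  define l where "l = aff y x (-x) y 0 0"
  have "(v2/m)\<^sup>2 + (v1/m)\<^sup>2 = 1" using m unfolding m_def by (intro unit_vector) (metis less_irrefl)
  from orthogonal_in_aff_box[OF this e] have k: "k \<in> aff_box 2" by (simp add: k_def)
  have l: "l \<in> aff_box 2" using orthogonal_in_aff_box[of y "-x" 1] xy by (simp add: l_def add.commute)
  have "k ** aff a b c d (r* v1) (r* v2) ** l = k ** (aff a b c d (r* v1) (r* v2) ** l)"
    by (simp add: matrix_mul_assoc)
  also have "aff a b c d (r* v1) (r* v2) ** l = aff (a*y - b*x) v1 (c*y - d*x) v2 (r* v1) (r* v2)"
    unfolding l_def aff_mult v1_def v2_def by simp
  also have "k ** \<dots> = aff (\<bar>a*d - b*c\<bar> / m) 0 ((v1 * (a*y - b*x) + v2 * (c*y - d*x)) / m) m 0 (r*m)"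
    unfolding k_def aff_mult aff_eq_iff
  proof (intro conjI)
    have "e * (v2 / m) * (a*y - b*x) + - (e * (v1 / m)) * (c*y - d*x)
       = e * (v2 * (a*y - b*x) - v1 * (c*y - d*x)) / m" using m by (simp add: field_simps)
    then show "e * (v2 / m) * (a*y - b*x) + - (e * (v1 / m)) * (c*y - d*x) = \<bar>a*d - b*c\<bar> / m"
      unfolding det eD .
    have "v1 / m * v1 + v2 / m * v2 = (m*m)/m" unfolding m2 by (simp add: add_divide_distrib)
    then show q: "v1 / m * v1 + v2 / m * v2 = m" using m by simp
    have "v1 / m * (r* v1) + v2 / m * (r* v2) + 0 = r * (v1 / m * v1 + v2 / m * v2)" by (simp add: algebra_simps)
    then show "v1 / m * (r* v1) + v2 / m * (r* v2) + 0 = r * m" unfolding q .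
  qed (use m in \<open>simp_all add: field_simps\<close>)
  finally show "\<exists>k\<in>aff_box 2. \<exists>l\<in>aff_box 2. k ** aff a b c d (r* v1) (r* v2) ** l =
      aff (\<bar>a*d - b*c\<bar> / m) 0 ((v1 * (a*y - b*x) + v2 * (c*y - d*x)) / m) m 0 (r*m)"
    using k l by blast
qed

lemma near_L_B1:
  fixes a b c d x y r :: real
  assumes D: "a * d - b * c \<noteq> 0" and xy: "x\<^sup>2 + y\<^sup>2 = 1"
    and v: "(a*x + b*y)\<^sup>2 + (c*x + d*y)\<^sup>2 = \<bar>a * d - b * c\<bar>"
  shows "aff a b c d (r*(a*x + b*y)) (r*(c*x + d*y)) \<in> near L_B1 2"
proof -
  have "\<bar>a * d - b * c\<bar> / sqrt \<bar>a * d - b * c\<bar> = sqrt \<bar>a * d - b * c\<bar>"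
    by (simp add: real_div_sqrt)
  then show ?thesis
    using rotate_to_lower_triangular(2)[OF D xy, of r] rotate_to_lower_triangular(1)[OF D xy] D
    unfolding v by (force simp: near_def aff_in_L_B1)
qed

lemma near_L_D1:
  fixes a b c d x y r :: real
  assumes D: "a * d - b * c \<noteq> 0" and xy: "x\<^sup>2 + y\<^sup>2 = 1"
    and v: "(a*x + b*y) * (a*y - b*x) + (c*x + d*y) * (c*y - d*x) = 0"
  shows "aff a b c d (r*(a*x + b*y)) (r*(c*x + d*y)) \<in> near L_D1 2"
  using rotate_to_lower_triangular(2)[OF D xy, of r] rotate_to_lower_triangular(1)[OF D xy] D
  unfolding v by (force simp: near_def aff_in_L_D1)

lemma continuous_sign_change_imp_zero:
  fixes f :: "real \<Rightarrow> real"
  assumes "continuous_on UNIV f" "f s \<le> 0" "0 \<le> f t"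
  shows "\<exists>x. f x = 0"
proof -
  have "connected (range f)" using assms(1) by (intro connected_continuous_image) auto
  then have "{f s..f t} \<subseteq> range f" by (intro connected_contains_Icc) auto
  then show ?thesis using assms(2,3) by (metis (no_types) atLeastAtMost_iff imageE subsetD)
qed

text \<open>Turning the unit vector by a right angle changes the sign of the inner product of the images
  of the vector and its normal, so it vanishes somewhere in between (this is the singular value
  decomposition).\<close>

lemma exists_orthogonal_images:
  fixes a b c d :: real
  shows "\<exists>x y. x\<^sup>2 + y\<^sup>2 = 1 \<and> (a*x + b*y) * (a*y - b*x) + (c*x + d*y) * (c*y - d*x) = 0"
proof -
  define f where "f t = (a * cos t + b * sin t) * (a * sin t - b * cos t)
     + (c * cos t + d * sin t) * (c * sin t - d * cos t)" for t
  have cont: "continuous_on UNIV f" unfolding f_def by (intro continuous_intros)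
  have f: "f (pi/2) = - f 0" by (simp add: f_def)
  have "\<exists>t. f t = 0"
  proof (cases "f 0 \<le> 0")
    case True
    then show ?thesis using f by (intro continuous_sign_change_imp_zero[OF cont, of 0 "pi/2"]) auto
  next
    case False
    then show ?thesis using f by (intro continuous_sign_change_imp_zero[OF cont, of "pi/2" 0]) auto
  qed
  then show ?thesis unfolding f_def by (metis sin_cos_squared_add2)
qed

text \<open>The squared lengths of the two orthogonal images multiply to the square of the determinant,
  so one is at most and the other at least its absolute value; the intermediate value theorem
  applies.\<close>

lemma exists_mean_stretch:
  fixes a b c d :: real
  shows "\<exists>x y. x\<^sup>2 + y\<^sup>2 = 1 \<and> (a*x + b*y)\<^sup>2 + (c*x + d*y)\<^sup>2 = \<bar>a*d - b*c\<bar>"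
proof -
  define D where "D = \<bar>a*d - b*c\<bar>"
  obtain x y where xy: "x\<^sup>2 + y\<^sup>2 = 1"
    and orth: "(a*x + b*y) * (a*y - b*x) + (c*x + d*y) * (c*y - d*x) = 0"
    using exists_orthogonal_images by blast
  obtain t where t: "x = cos t" "y = sin t" using xy sincos_total_2pi by metis
  define f where "f t = (a * cos t + b * sin t)\<^sup>2 + (c * cos t + d * sin t)\<^sup>2 - D" for t
  have cont: "continuous_on UNIV f" unfolding f_def by (intro continuous_intros)
  have 1: "f t + D = (a*x + b*y)\<^sup>2 + (c*x + d*y)\<^sup>2" by (simp add: f_def t)
  have 2: "f (t - pi/2) + D = (a*y - b*x)\<^sup>2 + (c*y - d*x)\<^sup>2"
    by (simp add: f_def t cos_diff sin_diff)
  have "(f t + D) * (f (t - pi/2) + D) =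
     ((a*x + b*y) * (a*y - b*x) + (c*x + d*y) * (c*y - d*x))\<^sup>2 + ((a*d - b*c) * (x\<^sup>2 + y\<^sup>2))\<^sup>2"
    unfolding 1 2 by (simp add: algebra_simps power2_eq_square)
  also have "\<dots> = D * D" unfolding orth xy D_def by (simp add: power2_eq_square)
  finally have prod: "(f t + D) * (f (t - pi/2) + D) = D * D" .
  have nn: "0 \<le> f t + D" "0 \<le> f (t - pi/2) + D" "0 \<le> D" unfolding 1 2 by (simp_all add: D_def)
  have "\<exists>t. f t = 0"
  proof (cases "f t = 0 \<or> f (t - pi/2) = 0")
    case False
    consider "f t < 0" "f (t - pi/2) < 0" | "f t > 0" "f (t - pi/2) > 0"
      | "f t \<le> 0" "f (t - pi/2) \<ge> 0" | "f t \<ge> 0" "f (t - pi/2) \<le> 0" by linarith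
    then show ?thesis
    proof cases
      case 1
      then have "(f t + D) * (f (t - pi/2) + D) < D * D" using nn by (intro mult_strict_mono) auto
      with prod show ?thesis by simp
    next
      case 2
      then have "D * D < (f t + D) * (f (t - pi/2) + D)" using nn by (intro mult_strict_mono) auto
      with prod show ?thesis by simp
    qed (use continuous_sign_change_imp_zero[OF cont] in blast)+
  qed blast
  then obtain s where "f s = 0" by blast
  then show ?thesis
    by (intro exI[of _ "cos s"] exI[of _ "sin s"]) (simp add: f_def D_def)
qed

lemma near_linear:
  assumes "a * d - b * c \<noteq> 0" "L = L_B1 \<or> L = L_D1"
  shows "aff a b c d 0 0 \<in> near L 2"
proof -
  obtain x y where 1: "x\<^sup>2 + y\<^sup>2 = 1" "(a*x + b*y)\<^sup>2 + (c*x + d*y)\<^sup>2 = \<bar>a*d - b*c\<bar>"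
    using exists_mean_stretch by blast
  obtain x' y' where 2: "x'\<^sup>2 + y'\<^sup>2 = 1"
     "(a*x' + b*y') * (a*y' - b*x') + (c*x' + d*y') * (c*y' - d*x') = 0"
    using exists_orthogonal_images by blast
  show ?thesis
    using near_L_B1[OF assms(1) 1, of 0] near_L_D1[OF assms(1) 2, of 0] assms(2) by auto
qed

definition fixes_pt :: "real^3^3 \<Rightarrow> real \<Rightarrow> real \<Rightarrow> bool" where
  "fixes_pt h x y \<longleftrightarrow> h *v vector [x, y, 1] = vector [x, y, 1]"

lemma fixes_pt_aff [simp]: "fixes_pt (aff a b c d p q) x y \<longleftrightarrow> a*x + b*y + p = x \<and> c*x + d*y + q = y"
  by (simp add: fixes_pt_def vec_eq_iff forall_3 matrix_vector_mult_def sum_3)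

lemma near_fixed_point:
  assumes "1 \<le> R" "\<bar>x\<bar> \<le> R" "\<bar>y\<bar> \<le> R" "h \<in> carrier aff_group" "fixes_pt h x y"
    and L: "L = L_B1 \<or> L = L_D1"
  shows "h \<in> near L (6 * R)"
proof -
  obtain a b c d p q where h: "h = aff a b c d p q" and D: "a * d - b * c \<noteq> 0"
    using assms(4) by (auto simp: carrier_iff_aff)
  have fixed: "a*x + b*y + p = x" "c*x + d*y + q = y" using assms(5) by (simp_all add: h)
  have "aff 1 0 0 1 (-x) (-y) ** h ** aff 1 0 0 1 x y = aff a b c d 0 0"
    using fixed by (simp add: h aff_mult algebra_simps)
  moreover have "aff 1 0 0 1 (-x) (-y) \<in> aff_box R" "aff 1 0 0 1 x y \<in> aff_box R"
    using assms by (simp_all add: aff_in_aff_box)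
  ultimately show ?thesis
    using near_shift[of "aff 1 0 0 1 (-x) (-y)" R "aff 1 0 0 1 x y" h L 2] near_linear[OF D L] assms(4)
    by (simp add: mult.commute)
qed

text \<open>Rotate the translation part to the second axis and cancel the bounded linear part from the
  right: what remains is a translation that lies in both subgroups \<open>L\<close>.\<close>

lemma near_bounded_linear_part:
  assumes R: "1 \<le> R" and bd: "\<bar>a\<bar> \<le> R" "\<bar>b\<bar> \<le> R" "\<bar>c\<bar> \<le> R" "\<bar>d\<bar> \<le> R" "1 \<le> R * \<bar>a * d - b * c\<bar>"
    and L: "L = L_B1 \<or> L = L_D1"
  shows "aff a b c d p q \<in> near L (2 * (3 * 2 * R)^3)"
proof -
  define u where "u = sqrt (p\<^sup>2 + q\<^sup>2)"
  obtain x y where xy: "x\<^sup>2 + y\<^sup>2 = 1" and pq: "x * p - y * q = 0"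
  proof (cases "u = 0")
    case True
    then have "p = 0" "q = 0" by (auto simp: u_def sum_power2_eq_zero_iff)
    then show ?thesis using that[of 1 0] by simp
  next
    case False
    then have "(q/u)\<^sup>2 + (p/u)\<^sup>2 = 1" unfolding u_def by (intro unit_vector) simp
    then show ?thesis using that[of "q/u" "p/u"] by simp
  qed
  define k where "k = aff x (-y) y x 0 0"
  define A where "A = k ** aff a b c d 0 0"
  have k: "k \<in> aff_box 2" using orthogonal_in_aff_box[OF xy, of 1] by (simp add: k_def)
  have "aff a b c d 0 0 \<in> aff_box R" using R bd by (simp add: aff_in_aff_box)
  from aff_box_mult[OF k this] have A: "A \<in> aff_box (3 * 2 * R)" unfolding A_def .
  then have iA: "inv\<^bsub>aff_group\<^esub> A \<in> aff_box (2 * (3 * 2 * R)^3)" by (rule aff_box_inv)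
  have "k ** aff a b c d p q = aff 1 0 0 1 0 (y*p + x*q) ** A"
    using pq by (simp add: A_def k_def aff_mult)
  then have "k ** aff a b c d p q ** inv\<^bsub>aff_group\<^esub> A =
      aff 1 0 0 1 0 (y*p + x*q) ** (A ** inv\<^bsub>aff_group\<^esub> A)"
    by (simp add: matrix_mul_assoc)
  then have eq: "k ** aff a b c d p q ** inv\<^bsub>aff_group\<^esub> A = aff 1 0 0 1 0 (y*p + x*q)"
    using inv_carrier(3)[OF aff_box_carrier[OF A]] by simp
  have inL: "aff 1 0 0 1 0 (y*p + x*q) \<in> L" using L by (auto simp: aff_in_L_B1 aff_in_L_D1)
  have "2 \<le> 2 * (3 * 2 * R)^3" using R one_le_power[of "3*2*R" 3] by simp
  then have k': "k \<in> aff_box (2 * (3 * 2 * R)^3)" using aff_box_mono[OF k] by simp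
  have "a * d - b * c \<noteq> 0" using bd(5) by auto
  then have "aff a b c d p q \<in> carrier aff_group" by simp
  moreover have "k ** aff a b c d p q ** inv\<^bsub>aff_group\<^esub> A \<in> L" unfolding eq by (rule inL)
  ultimately show ?thesis unfolding near_def using k' iA by blast
qed

section \<open>Iterated squares and normal forms\<close>

lemma lin_det_bound:
  assumes "h \<in> aff_box S"
  shows "\<bar>lin_det h\<bar> \<le> 2 * (S * S)"
proof -
  have "\<bar>h$1$1 * h$2$2\<bar> \<le> S * S" "\<bar>h$1$2 * h$2$1\<bar> \<le> S * S"
    unfolding abs_mult using assms aff_box_ge_1[OF assms] by (auto simp: aff_box_def intro!: mult_mono)
  then show ?thesis unfolding lin_det_def by linarith
qed

lemma two_power_bounded_imp_zero:
  fixes x :: real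
  assumes "\<And>n. 2^n * \<bar>x\<bar> \<le> S"
  shows "x = 0"
proof (rule ccontr)
  assume "x \<noteq> 0"
  moreover obtain n where "S / \<bar>x\<bar> < 2^n" using real_arch_pow[of 2] by auto
  ultimately show False using assms[of n] by (simp add: field_simps)
qed

lemma iterated_square_bounded_imp_le_1:
  fixes x :: real
  assumes "\<And>n. x^(2^n) \<le> S"
  shows "x \<le> 1"
proof (rule ccontr)
  assume "\<not> x \<le> 1"
  then obtain n where "S < x^n" using real_arch_pow[of x S] by auto
  also have "x^n \<le> x^(2^n)" using \<open>\<not> x \<le> 1\<close> by (intro power_increasing) (auto intro: less_imp_le)
  finally show False using assms[of n] by simp
qed

text \<open>Boundedness of the cyclic group of \<open>h\<close> is only ever tested on \<open>h ^ (2 ^ n)\<close>, for which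
  determinant and trace satisfy simple recursions.\<close>

definition squares :: "real^3^3 \<Rightarrow> nat \<Rightarrow> real^3^3" where
  "squares h n = ((\<lambda>x. x ** x) ^^ n) h"

lemma squares_0 [simp]: "squares h 0 = h"
  and squares_Suc [simp]: "squares h (Suc n) = squares h n ** squares h n"
  by (simp_all add: squares_def)

lemma squares_carrier: "h \<in> carrier aff_group \<Longrightarrow> squares h n \<in> carrier aff_group"
  by (induction n) (auto intro: carrier_mult)

lemma lin_det_squares: "h \<in> carrier aff_group \<Longrightarrow> lin_det (squares h n) = lin_det h ^ (2^n)"
  by (induction n) (auto simp: lin_det_mult squares_carrier power_add mult_2)

lemma fixes_pt_squares: "fixes_pt h x y \<Longrightarrow> fixes_pt (squares h n) x y"
  by (induction n) (auto simp: fixes_pt_def simp flip: matrix_vector_mul_assoc)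

lemma squares_conj:
  assumes "h ** g = g ** k"
  shows "squares h n ** g = g ** squares k n"
proof (induction n)
  case 0
  show ?case using assms by simp
next
  case (Suc n)
  have "squares h (Suc n) ** g = squares h n ** (squares h n ** g)"
    by (simp only: squares_Suc matrix_mul_assoc[symmetric])
  also have "\<dots> = squares h n ** (g ** squares k n)" by (simp only: Suc.IH)
  also have "\<dots> = (squares h n ** g) ** squares k n" by (rule matrix_mul_assoc)
  also have "\<dots> = (g ** squares k n) ** squares k n" by (simp only: Suc.IH)
  also have "\<dots> = g ** squares k (Suc n)"
    by (simp only: squares_Suc matrix_mul_assoc[symmetric])
  finally show ?case .
qed

lemma squares_diag: "squares (aff l 0 0 1 0 u) n = aff (l^(2^n)) 0 0 1 0 (2^n * u)"
proof (induction n)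
  case (Suc n)
  have "l^(2^Suc n) = l^(2^n) * l^(2^n)" by (simp add: mult_2 power_add)
  moreover have "2^Suc n * u = 2^n * u + 2^n * u" by simp
  ultimately show ?case by (simp only: squares_Suc Suc aff_mult aff_eq_iff) simp
qed simp

lemma squares_translation: "squares (aff 1 0 0 1 p q) n = aff 1 0 0 1 (2^n * p) (2^n * q)"
proof (induction n)
  case (Suc n)
  then show ?case by (simp only: squares_Suc aff_mult aff_eq_iff) simp
qed simp

lemma squares_unipotent:
  assumes "m * m + n * k = 0"
  shows "\<exists>p' q'. squares (aff (1 + m) n k (1 - m) p q) i =
     aff (1 + 2^i * m) (2^i * n) (2^i * k) (1 - 2^i * m) p' q'"
proof (induction i)
  case (Suc i)
  then obtain p' q' where IH: "squares (aff (1 + m) n k (1 - m) p q) i =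
     aff (1 + 2^i * m) (2^i * n) (2^i * k) (1 - 2^i * m) p' q'" by blast
  have z: "(2^i * m) * (2^i * m) + (2^i * n) * (2^i * k) = 0"
  proof -
    have "(2^i * m) * (2^i * m) + (2^i * n) * (2^i * k) = 2^i * 2^i * (m * m + n * k)"
      by (simp add: algebra_simps)
    then show ?thesis using assms by simp
  qed
  let ?m = "2^i * m" and ?n = "2^i * n" and ?k = "2^i * k"
  have "(1 + ?m) * (1 + ?m) + ?n * ?k = 1 + 2^(Suc i) * m"
    "(1 + ?m) * ?n + ?n * (1 - ?m) = 2^(Suc i) * n"
    "?k * (1 + ?m) + (1 - ?m) * ?k = 2^(Suc i) * k"
    "?k * ?n + (1 - ?m) * (1 - ?m) = 1 - 2^(Suc i) * m"
  proof -
    have "(1 + ?m) * (1 + ?m) + ?n * ?k = 1 + 2 * ?m + (?m * ?m + ?n * ?k)"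
      "?k * ?n + (1 - ?m) * (1 - ?m) = 1 - 2 * ?m + (?m * ?m + ?n * ?k)"
      by (simp_all add: algebra_simps)
    then show "(1 + ?m) * (1 + ?m) + ?n * ?k = 1 + 2^(Suc i) * m"
      "?k * ?n + (1 - ?m) * (1 - ?m) = 1 - 2^(Suc i) * m"
      unfolding z by simp_all
  qed (simp_all add: algebra_simps)
  then show ?case unfolding squares_Suc IH aff_mult aff_eq_iff by blast
qed auto

lemma lin_tr_square:
  assumes "h \<in> carrier aff_group"
  shows "lin_tr (h ** h) = (lin_tr h)\<^sup>2 - 2 * lin_det h"
  using assms by (auto simp: carrier_iff_aff aff_mult power2_eq_square algebra_simps)

text \<open>The traces satisfy \<open>t' = t\<^sup>2 - 2\<close>, and \<open>2\<close> is a repelling fixed point of this recursion: the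
  excess of \<open>\<bar>t\<bar>\<close> over \<open>2\<close> at least doubles.\<close>

lemma squares_bounded_imp_trace_le_2:
  assumes h: "h \<in> carrier aff_group" "lin_det h = 1" and S: "\<And>n. squares h n \<in> aff_box S"
  shows "\<bar>lin_tr h\<bar> \<le> 2"
proof -
  define e where "e = \<bar>lin_tr h\<bar> - 2"
  have "e \<le> 0"
  proof (rule ccontr)
    assume "\<not> e \<le> 0"
    then have e: "e > 0" by simp
    have grow: "2 + e * 2^n \<le> \<bar>lin_tr (squares h n)\<bar>" for n
    proof (induction n)
      case (Suc n)
      let ?t = "\<bar>lin_tr (squares h n)\<bar>"
      have "lin_tr (squares h (Suc n)) = ?t\<^sup>2 - 2"
        using lin_tr_square[OF squares_carrier[OF h(1)]] lin_det_squares[OF h(1)] h(2) by simp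
      moreover have "(2 + e * 2^n)\<^sup>2 \<le> ?t\<^sup>2"
        using Suc e by (intro power_mono) auto
      moreover have "(2 + e * 2^n)\<^sup>2 = 4 + 4 * (e * 2^n) + (e * 2^n)\<^sup>2"
        by (simp add: power2_eq_square algebra_simps)
      moreover have "0 \<le> e * 2^n" using e by simp
      moreover have "0 \<le> (e * 2^n)\<^sup>2" by simp
      moreover have "e * 2^(Suc n) = 2 * (e * 2^n)" by simp
      ultimately show ?case by linarith
    qed (simp add: e_def)
    have "2^n * \<bar>e\<bar> \<le> 2 * S" for n
    proof -
      have "\<bar>squares h n$1$1\<bar> \<le> S" "\<bar>squares h n$2$2\<bar> \<le> S" using S[of n] by (auto simp: aff_box_def)
      then have "\<bar>lin_tr (squares h n)\<bar> \<le> 2 * S" unfolding lin_tr_def by linarith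
      with grow[of n] e show ?thesis by (simp add: mult.commute)
    qed
    from two_power_bounded_imp_zero[OF this] e show False by simp
  qed
  then show ?thesis by (simp add: e_def)
qed

lemma exists_fixed_point:
  assumes "h \<in> carrier aff_group" "lin_det h - lin_tr h + 1 \<noteq> 0"
  shows "\<exists>x y. fixes_pt h x y"
proof -
  obtain a b c d p q where h: "h = aff a b c d p q" using assms(1) by (auto simp: carrier_iff_aff)
  define E where "E = (a - 1) * (d - 1) - b * c"
  have E: "E \<noteq> 0" using assms(2) by (simp add: h E_def algebra_simps)
  have "fixes_pt h ((b*q - (d - 1)*p) / E) ((c*p - (a - 1)*q) / E)"
  proof -
    have "a * ((b*q - (d - 1)*p) / E) + b * ((c*p - (a - 1)*q) / E) - (b*q - (d - 1)*p) / E = - (E * p) / E"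
      by (simp add: E_def field_simps add_divide_distrib diff_divide_distrib)
    moreover have "c * ((b*q - (d - 1)*p) / E) + d * ((c*p - (a - 1)*q) / E) - (c*p - (a - 1)*q) / E = - (E * q) / E"
      by (simp add: E_def field_simps add_divide_distrib diff_divide_distrib)
    ultimately show ?thesis using E by (simp add: h)
  qed
  then show ?thesis by blast
qed

text \<open>The columns of \<open>g\<close> are eigenvectors for \<open>l\<close> and \<open>1\<close>. The translation part can be removed
  along the first of them, since \<open>l - 1\<close> is invertible there.\<close>

lemma exists_conj_diagonal:
  assumes "h \<in> carrier aff_group" "lin_det h = l" "lin_tr h = 1 + l" "l \<noteq> 1"
  shows "\<exists>g\<in>carrier aff_group. \<exists>u. h ** g = g ** aff l 0 0 1 0 u"
proof -
  obtain a b c d p q where h: "h = aff a b c d p q" using assms(1) by (auto simp: carrier_iff_aff)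
  define m where "m = a - 1"
  define k where "k = l - 1"
  have k: "k \<noteq> 0" using assms by (simp add: k_def)
  have a: "a = 1 + m" and l: "l = 1 + k" by (simp_all add: m_def k_def)
  have d: "d = 1 + k - m" using assms(3) by (simp add: h a l)
  have bc: "b * c = m * (k - m)" using assms(2) by (simp add: h a l d algebra_simps)
  \<comment> \<open>Eigenvectors \<open>f\<close> for \<open>l\<close> and \<open>w\<close> for \<open>1\<close>; the two cases avoid the zero vector.\<close>
  obtain f1 f2 w1 w2 where det: "f1 * w2 - w1 * f2 \<noteq> 0"
    and f: "m * f1 + b * f2 = k * f1" "c * f1 + (k - m) * f2 = k * f2"
    and w: "m * w1 + b * w2 = 0" "c * w1 + (k - m) * w2 = 0"
  proof (cases "m = 0")
    case True
    show ?thesis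
      by (rule that[of b c "-k" k]) (use True bc k in \<open>auto simp: algebra_simps\<close>)
  next
    case False
    have "m * -m - b * c = - m * k" unfolding bc by (simp add: algebra_simps)
    then have "m * -m - b * c \<noteq> 0" using False k by simp
    from that[OF this] show ?thesis using bc by (simp add: algebra_simps)
  qed
  define D where "D = f1 * w2 - w1 * f2"
  define r where "r = (p * w2 - q * w1) / D"
  define u where "u = (f1 * q - f2 * p) / D"
  have D: "D \<noteq> 0" using det by (simp add: D_def)
  have p: "r * f1 + u * w1 = p"
  proof -
    have "r * f1 + u * w1 = (D * p) / D" unfolding r_def u_def
      by (simp add: D_def algebra_simps flip: add_divide_distrib)
    then show ?thesis using D by simp
  qed
  have q: "r * f2 + u * w2 = q"
  proof -
    have "r * f2 + u * w2 = (D * q) / D" unfolding r_def u_def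
      by (simp add: D_def algebra_simps flip: add_divide_distrib)
    then show ?thesis using D by simp
  qed
  define s where "s = - r / k"
  have s: "s * k = - r" using k by (simp add: s_def)
  define g where "g = aff f1 w1 f2 w2 (s * f1) (s * f2)"
  have "h ** g = g ** aff l 0 0 1 0 u"
    unfolding h g_def aff_mult aff_eq_iff
  proof (intro conjI)
    have "a * (s * f1) + b * (s * f2) = s * (m * f1 + b * f2) + s * f1"
      by (simp add: a algebra_simps)
    also have "\<dots> = (s * k) * f1 + s * f1" unfolding f by simp
    finally show "a * (s * f1) + b * (s * f2) + p = f1 * 0 + w1 * u + s * f1"
      unfolding s using p by (simp add: algebra_simps)
    have "c * (s * f1) + d * (s * f2) = s * (c * f1 + (k - m) * f2) + s * f2"
      by (simp add: d algebra_simps)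
    also have "\<dots> = (s * k) * f2 + s * f2" unfolding f by simp
    finally show "c * (s * f1) + d * (s * f2) + q = f2 * 0 + w2 * u + s * f2"
      unfolding s using q by (simp add: algebra_simps)
  qed (use f w in \<open>simp_all add: a d l algebra_simps\<close>)
  moreover have "g \<in> carrier aff_group" using det by (simp add: g_def)
  ultimately show ?thesis by blast
qed

text \<open>For \<open>L_D1\<close> nothing has to be moved far. For \<open>L_B1\<close> the translation part has to be parallel to
  the image of a vector of mean stretch, which is a multiple of \<open>(sqrt M, 1)\<close>; translating by
  \<open>v / sqrt M\<close> from the right achieves this, and this is bounded when \<open>M\<close> grows faster than
  \<open>v\<^sup>2\<close>.\<close>

lemma near_shear_diagonal:
  assumes M: "0 < M" and R: "1 \<le> R" "\<bar>v / sqrt M\<bar> \<le> R" and L: "L = L_B1 \<or> L = L_D1"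
  shows "aff M 0 0 1 0 v \<in> near L (6 * R)"
  using L
proof
  assume L: "L = L_D1"
  have "aff M 0 0 1 0 v \<in> near L_D1 2"
    using near_L_D1[of M 1 0 0 0 1 v] M by simp
  then show ?thesis unfolding L using R(1) near_mono by fastforce
next
  assume L: "L = L_B1"
  define r where "r = sqrt M"
  have r: "r > 0" "r * r = M" using M by (simp_all add: r_def)
  define x where "x = 1 / sqrt (1\<^sup>2 + r\<^sup>2)"
  define y where "y = r / sqrt (1\<^sup>2 + r\<^sup>2)"
  have s0: "sqrt (1\<^sup>2 + r\<^sup>2) \<noteq> 0" by (simp add: add_nonneg_eq_0_iff)
  have xy: "x\<^sup>2 + y\<^sup>2 = 1" using unit_vector[OF s0] by (simp add: x_def y_def add.commute)
  have x: "x \<noteq> 0" using s0 by (simp add: x_def)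
  have yx: "y = r * x" by (simp add: y_def x_def)
  have "(M*x + 0*y)\<^sup>2 + (0*x + 1*y)\<^sup>2 = M * (x\<^sup>2 + y\<^sup>2)"
    unfolding yx r(2)[symmetric] by (simp add: power2_eq_square algebra_simps)
  then have norm: "(M*x + 0*y)\<^sup>2 + (0*x + 1*y)\<^sup>2 = \<bar>M * 1 - 0 * 0\<bar>" using xy M by simp
  have "M * 1 - 0 * 0 \<noteq> 0" using M by simp
  from near_L_B1[OF this xy norm, of "v / y"]
  have "aff M 0 0 1 (v / y * (M * x)) v \<in> near L_B1 2" using x r by (simp add: yx)
  moreover have "v / y * (M * x) = M * (v / r)"
    using x r by (simp add: yx field_simps)
  ultimately have "aff 1 0 0 1 0 0 ** aff M 0 0 1 0 v ** aff 1 0 0 1 (v / r) 0 \<in> near L_B1 2"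
    by (simp add: aff_mult)
  from near_shift[OF _ _ _ this, of R] show ?thesis
    using R M by (simp add: aff_in_aff_box L r_def mult.commute)
qed

section \<open>Screw motions\<close>

text \<open>For \<open>t \<noteq> 0\<close> the linear part is parabolic and there is no fixed point; \<open>screw\<close> is a
  one-parameter group with image \<open>N_parab\<close>.\<close>

definition screw :: "real \<Rightarrow> real^3^3" where
  "screw t = aff 1 0 t 1 t (t\<^sup>2 / 2)"

lemma screw_add: "screw s ** screw t = screw (s + t)"
  by (simp add: screw_def aff_mult power2_eq_square field_simps)

lemma inv_screw: "inv\<^bsub>aff_group\<^esub> screw t = screw (- t)"
  by (simp add: screw_def inv_aff power2_eq_square)

lemma tendsto_screw:
  assumes "(x \<longlongrightarrow> l) F"
  shows "((\<lambda>k. screw (x k)) \<longlongrightarrow> screw l) F"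
proof -
  have "\<forall>i j. ((\<lambda>k. screw (x k) $ i $ j) \<longlongrightarrow> screw l $ i $ j) F"
    unfolding forall_3 screw_def aff_nth using assms by (intro conjI tendsto_intros) auto
  then show ?thesis by (intro vec_tendstoI) auto
qed

lemma N_parab_eq: "N_parab = range screw"
  by (auto simp: N_parab_def screw_def aff_def)

lemma squares_screw: "squares (screw t) n = screw (2^n * t)"
proof (induction n)
  case (Suc n)
  have "2^n * t + 2^n * t = 2^Suc n * t" by simp
  then show ?case by (simp only: squares_Suc Suc screw_add)
qed simp

text \<open>The mean stretch of the shear is attained at the multiples of \<open>(1, - t / 2)\<close>, whose image
  \<open>(1, t / 2)\<close> happens to be parallel to the translation part \<open>(t, t\<^sup>2 / 2)\<close>. This coincidence
  is what separates \<open>L_B1\<close> from \<open>L_D1\<close>.\<close>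

lemma screw_near_L_B1: "screw t \<in> near L_B1 2"
proof -
  define s where "s = sqrt ((t/2)\<^sup>2 + 1\<^sup>2)"
  have "(t/2)\<^sup>2 + 1\<^sup>2 > 0" by (intro add_nonneg_pos) auto
  then have s: "s > 0" by (simp add: s_def)
  define x where "x = 1 / s"
  define y where "y = - (t/2) / s"
  have xy: "x\<^sup>2 + y\<^sup>2 = 1" using unit_vector[of "t/2" 1] s by (simp add: x_def y_def s_def)
  have y: "y = - (t/2) * x" by (simp add: x_def y_def)
  have "(1*x + 0*y)\<^sup>2 + (t*x + 1*y)\<^sup>2 = x\<^sup>2 + y\<^sup>2"
    unfolding y by (simp add: power2_eq_square algebra_simps)
  then have "(1*x + 0*y)\<^sup>2 + (t*x + 1*y)\<^sup>2 = \<bar>1 * 1 - 0 * t\<bar>" using xy by simp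
  from near_L_B1[OF _ xy this, of "t * s"] show ?thesis
    using s by (simp add: screw_def y x_def power2_eq_square)
qed

lemma not_thin_L_B1_N_parab: "\<not> thin L_B1 N_parab"
proof
  assume "thin L_B1 N_parab"
  then obtain S where S: "N_parab \<inter> near L_B1 2 \<subseteq> aff_box S" unfolding thin_def by blast
  then have "screw (\<bar>S\<bar> + 1) \<in> aff_box S" using screw_near_L_B1 by (auto simp: N_parab_eq)
  then have "\<bar>screw (\<bar>S\<bar> + 1)$2$1\<bar> \<le> S" unfolding aff_box_def by blast
  then show False by (simp add: screw_def)
qed

section \<open>Elements of a thin connected subgroup\<close>

text \<open>These conditions pass to conjugates of \<open>H\<close>, so that \<open>H\<close> can be brought into standard position
  without repeating what has been shown for it.\<close>

locale thin_subgroup =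
  fixes L H :: "(real^3^3) set"
  assumes L: "L = L_B1 \<or> L = L_D1"
    and sub: "subgroup H aff_group"
    and conn: "connected H"
    and thin: "thin L H"
begin

lemma in_carrier: "h \<in> H \<Longrightarrow> h \<in> carrier aff_group"
  using subgroup.mem_carrier[OF sub] .

lemma mult_mem: "g \<in> H \<Longrightarrow> h \<in> H \<Longrightarrow> g ** h \<in> H"
  using subgroup.m_closed[OF sub, of g h] by simp

lemma inv_mem: "h \<in> H \<Longrightarrow> inv\<^bsub>aff_group\<^esub> h \<in> H"
  using subgroup.m_inv_closed[OF sub] .

lemma one_mem: "mat 1 \<in> H"
  using subgroup.one_closed[OF sub] by simp

lemma squares_mem: "h \<in> H \<Longrightarrow> squares h n \<in> H"
  by (induction n) (auto intro: mult_mem)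

lemma near_bounded:
  obtains S where "\<And>h. h \<in> H \<Longrightarrow> h \<in> near L R \<Longrightarrow> h \<in> aff_box S"
  using thin unfolding thin_def by blast

lemma lin_det_pos:
  assumes "h \<in> H"
  shows "0 < lin_det h"
proof (rule ccontr)
  assume "\<not> 0 < lin_det h"
  have "connected (lin_det ` H)" using conn by (intro connected_continuous_image continuous_on_lin_det)
  moreover have "lin_det (mat 1) \<in> lin_det ` H" using one_mem by blast
  then have "1 \<in> lin_det ` H" by (simp add: aff_one)
  ultimately have "{lin_det h..1} \<subseteq> lin_det ` H" using assms by (intro connected_contains_Icc) auto
  then have "0 \<in> lin_det ` H" using \<open>\<not> 0 < lin_det h\<close> by auto
  then show False using in_carrier by (auto simp: carrier_iff_entries)
qed

lemma fixed_point_imp_squares_bounded: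
  assumes "h \<in> H" "fixes_pt h x y"
  obtains S where "\<And>n. squares h n \<in> aff_box S"
proof -
  define R where "R = max 1 (max \<bar>x\<bar> \<bar>y\<bar>)"
  obtain S where S: "\<And>h. h \<in> H \<Longrightarrow> h \<in> near L (6 * R) \<Longrightarrow> h \<in> aff_box S"
    using near_bounded[of "6 * R"] by blast
  have "squares h n \<in> aff_box S" for n
  proof (rule S)
    show "squares h n \<in> H" using assms squares_mem by blast
    then show "squares h n \<in> near L (6 * R)"
      using assms L by (intro near_fixed_point[of R x y] in_carrier fixes_pt_squares) (auto simp: R_def)
  qed
  then show ?thesis by (rule that)
qed

lemma fixed_point_imp_lin_det_1:
  assumes h: "h \<in> H" "fixes_pt h x y"
  shows "lin_det h = 1"
proof -
  obtain S where S: "\<And>n. squares h n \<in> aff_box S" using fixed_point_imp_squares_bounded[OF h] by blast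
  have pos: "0 < lin_det h" using lin_det_pos h by blast
  note det = lin_det_squares[OF in_carrier[OF h(1)]]
  have "lin_det h ^ (2^n) \<le> 2 * (S * S)" for n
    using lin_det_bound[OF S[of n]] det[of n] by simp
  then have "lin_det h \<le> 1" by (rule iterated_square_bounded_imp_le_1)
  moreover have "(1 / lin_det h) ^ (2^n) \<le> S" for n
  proof -
    have "1 \<le> S * \<bar>lin_det (squares h n)\<bar>" using S[of n] by (simp add: aff_box_def)
    also have "\<bar>lin_det (squares h n)\<bar> = lin_det h ^ (2^n)" using pos by (simp add: det)
    finally show ?thesis using pos by (simp add: power_divide field_simps)
  qed
  then have "1 / lin_det h \<le> 1" by (rule iterated_square_bounded_imp_le_1)
  ultimately show ?thesis using pos by (simp add: field_simps)
qed

text \<open>In the normal form the squares have linear part \<open>diag(l ^ (2 ^ n), 1)\<close> and translation part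
  \<open>2 ^ n * u\<close>. Exponential growth beats linear growth, so they stay near \<open>L\<close>; but their determinants
  are unbounded.\<close>

lemma no_eigenvalue_1_expanding:
  assumes h: "h \<in> H" and det: "lin_det h = l" and tr: "lin_tr h = 1 + l" and l: "1 < l"
  shows False
proof -
  obtain g u where g: "g \<in> carrier aff_group" and conj: "h ** g = g ** aff l 0 0 1 0 u"
    using exists_conj_diagonal[OF in_carrier[OF h] det tr] l by auto
  define e where "e = sqrt l - 1"
  have e: "e > 0" using l by (simp add: e_def)
  define R where "R = max 1 (\<bar>u\<bar> / e)"
  have near: "aff (l^(2^n)) 0 0 1 0 (2^n * u) \<in> near L (6 * R)" for n
  proof (rule near_shear_diagonal)
    have "1 + (2^n) * e \<le> (1 + e)^(2^n)" using Bernoulli_inequality[of e "2^n"] e by simp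
    also have "(1 + e)^(2^n) = sqrt (l^(2^n))" using l by (simp add: e_def real_sqrt_power)
    finally have "2^n * e \<le> sqrt (l^(2^n))" by simp
    moreover have "0 < sqrt (l^(2^n))" using l by simp
    ultimately have "2^n / sqrt (l^(2^n)) \<le> 1 / e" using e by (simp add: field_simps)
    from mult_right_mono[OF this, of "\<bar>u\<bar>"]
    have "\<bar>2^n * u / sqrt (l^(2^n))\<bar> \<le> \<bar>u\<bar> / e" using l by (simp add: abs_mult)
    then show "\<bar>2^n * u / sqrt (l^(2^n))\<bar> \<le> R" by (simp add: R_def)
  qed (use l L in \<open>auto simp: R_def\<close>)
  have "compactin aff_top {g, inv\<^bsub>aff_group\<^esub> g}"
    using g inv_carrier(1)[OF g] by (simp add: compactin_aff_top)
  then obtain r where r: "g \<in> aff_box r" "inv\<^bsub>aff_group\<^esub> g \<in> aff_box r"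
    using compact_subset_aff_box by (metis insert_subset)
  have near': "squares h n \<in> near L (3 * r * (6 * R))" for n
  proof (rule near_shift[OF r(2) r(1)])
    have "inv\<^bsub>aff_group\<^esub> g ** squares h n ** g = inv\<^bsub>aff_group\<^esub> g ** (squares h n ** g)"
      by (simp add: matrix_mul_assoc)
    also have "\<dots> = (inv\<^bsub>aff_group\<^esub> g ** g) ** squares (aff l 0 0 1 0 u) n"
      unfolding squares_conj[OF conj] by (simp add: matrix_mul_assoc)
    also have "\<dots> = aff (l^(2^n)) 0 0 1 0 (2^n * u)" using inv_carrier[OF g] by (simp add: squares_diag)
    finally show "inv\<^bsub>aff_group\<^esub> g ** squares h n ** g \<in> near L (6 * R)" using near by simp
  qed (use h in_carrier squares_mem in blast)
  obtain S where S: "\<And>h. h \<in> H \<Longrightarrow> h \<in> near L (3 * r * (6 * R)) \<Longrightarrow> h \<in> aff_box S"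
    using near_bounded[of "3 * r * (6 * R)"] by blast
  have "l^(2^n) \<le> 2 * (S * S)" for n
    using lin_det_bound[OF S[OF squares_mem[OF h] near'[of n]]] lin_det_squares[OF in_carrier[OF h], of n] det
    by simp
  then have "l \<le> 1" by (rule iterated_square_bounded_imp_le_1)
  with l show False by simp
qed

lemma lin_det_1:
  assumes h: "h \<in> H"
  shows "lin_det h = 1"
proof (cases "lin_det h - lin_tr h + 1 = 0")
  case False
  then show ?thesis using exists_fixed_point[OF in_carrier[OF h]] fixed_point_imp_lin_det_1[OF h] by blast
next
  case True
  define l where "l = lin_det h"
  have tr: "lin_tr h = 1 + l" and l: "0 < l" using True lin_det_pos[OF h] by (auto simp: l_def)
  have "\<not> 1 < l" using no_eigenvalue_1_expanding[OF h l_def[symmetric] tr] by blast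
  moreover have "\<not> l < 1"
  proof
    assume l1: "l < 1"
    obtain a b c d p q where h': "h = aff a b c d p q" and D: "a * d - b * c \<noteq> 0"
      using in_carrier[OF h] by (auto simp: carrier_iff_aff)
    have lD: "a * d - b * c = l" by (simp add: l_def h')
    have "lin_det (inv\<^bsub>aff_group\<^esub> h) * lin_det h = 1"
      using lin_det_mult[OF inv_carrier(1) in_carrier[OF h], OF in_carrier[OF h]]
        inv_carrier(2)[OF in_carrier[OF h]] by (simp add: aff_one)
    then have "lin_det (inv\<^bsub>aff_group\<^esub> h) = 1 / l" using l by (simp add: l_def field_simps)
    moreover have "lin_tr (inv\<^bsub>aff_group\<^esub> h) = 1 + 1 / l"
    proof -
      have "lin_tr (inv\<^bsub>aff_group\<^esub> h) = (a + d) / l"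
        by (simp add: h' inv_aff[OF D] lD add_divide_distrib)
      also have "\<dots> = 1 + 1 / l" using tr l by (simp add: h' add_divide_distrib)
      finally show ?thesis .
    qed
    ultimately show False using no_eigenvalue_1_expanding[OF inv_mem[OF h], of "1/l"] l l1 by simp
  qed
  ultimately show ?thesis by (simp add: l_def)
qed

lemma trace_le_2:
  assumes h: "h \<in> H"
  shows "\<bar>lin_tr h\<bar> \<le> 2"
proof (cases "lin_tr h = 2")
  case False
  then obtain x y where "fixes_pt h x y"
    using exists_fixed_point[OF in_carrier[OF h]] lin_det_1[OF h] by auto
  then show ?thesis
    using fixed_point_imp_squares_bounded[OF h] squares_bounded_imp_trace_le_2[OF in_carrier[OF h] lin_det_1[OF h]]
    by metis
qed simp

text \<open>The powers of a translation have bounded linear part.\<close>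

lemma translation_trivial:
  assumes "aff 1 0 0 1 p q \<in> H"
  shows "p = 0 \<and> q = 0"
proof -
  obtain S where S: "\<And>h. h \<in> H \<Longrightarrow> h \<in> near L (2 * (3 * 2 * 1)^3) \<Longrightarrow> h \<in> aff_box S"
    using near_bounded[of "2 * (3 * 2 * 1)^3"] by blast
  have "aff 1 0 0 1 (2^n * p) (2^n * q) \<in> aff_box S" for n
  proof (rule S)
    show "aff 1 0 0 1 (2^n * p) (2^n * q) \<in> H"
      using squares_mem[OF assms, of n] by (simp add: squares_translation)
    show "aff 1 0 0 1 (2^n * p) (2^n * q) \<in> near L (2 * (3 * 2 * 1)^3)"
      using L by (intro near_bounded_linear_part) auto
  qed
  then have "2^n * \<bar>p\<bar> \<le> S" "2^n * \<bar>q\<bar> \<le> S" for n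
    using aff_in_aff_box[OF aff_box_ge_1, of _ S] by (force simp: abs_mult)+
  then show ?thesis using two_power_bounded_imp_zero by blast
qed

lemma unipotent_fixed_point_trivial:
  assumes h: "aff (1 + m) n k (1 - m) p q \<in> H"
    and fp: "fixes_pt (aff (1 + m) n k (1 - m) p q) x y"
    and nil: "m * m + n * k = 0"
  shows "m = 0 \<and> n = 0 \<and> k = 0"
proof -
  let ?h = "aff (1 + m) n k (1 - m) p q"
  obtain S where S: "\<And>i. squares ?h i \<in> aff_box S" using fixed_point_imp_squares_bounded[OF h fp] by blast
  have "2^i * \<bar>m\<bar> \<le> 1 + S \<and> 2^i * \<bar>n\<bar> \<le> 1 + S \<and> 2^i * \<bar>k\<bar> \<le> 1 + S" for i
  proof -
    obtain p' q' where eq: "squares ?h i = aff (1 + 2^i * m) (2^i * n) (2^i * k) (1 - 2^i * m) p' q'"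
      using squares_unipotent[OF nil] by blast
    note B = S[of i, unfolded eq]
    have "\<bar>1 + 2^i * m\<bar> \<le> S" "\<bar>2^i * n\<bar> \<le> S" "\<bar>2^i * k\<bar> \<le> S"
      using B aff_in_aff_box[OF aff_box_ge_1[OF B]] by auto
    moreover have "\<bar>2^i * m\<bar> = 2^i * \<bar>m\<bar>" "\<bar>2^i * n\<bar> = 2^i * \<bar>n\<bar>" "\<bar>2^i * k\<bar> = 2^i * \<bar>k\<bar>"
      by (simp_all add: abs_mult)
    ultimately show ?thesis by linarith
  qed
  then show ?thesis using two_power_bounded_imp_zero by blast
qed


section \<open>Elliptic and parabolic linear parts\<close>

lemma bounded_linear_part_imp_bounded:
  assumes "\<And>a b c d p q. aff a b c d p q \<in> H \<Longrightarrow> \<bar>a\<bar> \<le> R \<and> \<bar>b\<bar> \<le> R \<and> \<bar>c\<bar> \<le> R \<and> \<bar>d\<bar> \<le> R"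
  shows "\<exists>S. H \<subseteq> aff_box S"
proof -
  define T where "T = max 1 R"
  have T: "1 \<le> T" "R \<le> T" by (auto simp: T_def)
  obtain S where S: "\<And>h. h \<in> H \<Longrightarrow> h \<in> near L (2 * (3 * 2 * T)^3) \<Longrightarrow> h \<in> aff_box S"
    using near_bounded[of "2 * (3 * 2 * T)^3"] by blast
  have "h \<in> aff_box S" if h: "h \<in> H" for h
  proof -
    obtain a b c d p q where h': "h = aff a b c d p q"
      using in_carrier[OF h] by (auto simp: carrier_iff_aff)
    have "a * d - b * c = 1" using lin_det_1[OF h] by (simp add: h')
    moreover have "\<bar>a\<bar> \<le> T \<and> \<bar>b\<bar> \<le> T \<and> \<bar>c\<bar> \<le> T \<and> \<bar>d\<bar> \<le> T"
      using assms[OF h[unfolded h']] T by auto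
    ultimately have "h \<in> near L (2 * (3 * 2 * T)^3)"
      unfolding h' using L T by (intro near_bounded_linear_part) auto
    with S h show ?thesis by blast
  qed
  then show ?thesis by blast
qed

text \<open>For \<open>A\<close> and \<open>B\<close> in \<open>SL\<^sub>2\<close> the trace of the commutator is \<open>2 - det (A B - B A)\<close>, and \<open>A B - B A\<close>
  has trace zero, so that minus its determinant is the expression bounded here.\<close>

lemma commutator_trace_le_2:
  assumes g: "aff a b c d p q \<in> H" and h: "aff x y z w p' q' \<in> H"
  shows "(b*z - y*c)\<^sup>2 + (y*(a - d) - b*(x - w)) * (c*(x - w) - z*(a - d)) \<le> 0"
proof -
  let ?g = "aff a b c d p q" and ?h = "aff x y z w p' q'"
  have D: "a*d - b*c = 1" "x*w - y*z = 1" using lin_det_1[OF g] lin_det_1[OF h] by simp_all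
  have inv: "inv\<^bsub>aff_group\<^esub> ?g = aff d (-b) (-c) a (b*q - d*p) (c*p - a*q)"
    "inv\<^bsub>aff_group\<^esub> ?h = aff w (-y) (-z) x (y*q' - w*p') (z*p' - x*q')"
    using D by (simp_all add: inv_aff)
  have k: "?g ** ?h ** inv\<^bsub>aff_group\<^esub> ?g ** inv\<^bsub>aff_group\<^esub> ?h \<in> H"
    using g h by (intro mult_mem inv_mem)
  have "lin_tr (?g ** ?h ** inv\<^bsub>aff_group\<^esub> ?g ** inv\<^bsub>aff_group\<^esub> ?h) =
     2 * ((a*d - b*c) * (x*w - y*z)) +
     ((b*z - y*c)\<^sup>2 + (y*(a - d) - b*(x - w)) * (c*(x - w) - z*(a - d)))"
    unfolding inv by (simp add: aff_mult algebra_simps power2_eq_square)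
  with D trace_le_2[OF k] show ?thesis by simp
qed

text \<open>Let \<open>A\<close> be the elliptic linear part of \<open>g\<close> and \<open>M = A B - B A\<close>. Since \<open>M A\<close> has trace zero, one
  entry of \<open>M\<close> can be eliminated from \<open>- det M\<close>, and what remains is a quadratic form whose
  discriminant is that of the characteristic polynomial of \<open>A\<close>: it is positive definite. The
  commutator bound therefore forces \<open>M = 0\<close>. Then \<open>B\<close> lies in the span of \<open>1\<close> and \<open>A\<close>, on which the
  determinant is a definite form, so \<open>det B = 1\<close> bounds \<open>B\<close>.\<close>

lemma elliptic_imp_bounded:
  assumes g: "g \<in> H" and ell: "\<bar>lin_tr g\<bar> < 2"
  shows "\<exists>S. H \<subseteq> aff_box S"
proof -
  obtain a b c d p q where g': "g = aff a b c d p q"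
    using in_carrier[OF g] by (auto simp: carrier_iff_aff)
  have D: "a*d - b*c = 1" using lin_det_1[OF g] by (simp add: g')
  define E where "E = - ((a - d)\<^sup>2 + 4 * b * c)"
  have "\<bar>a + d\<bar>\<^sup>2 < 2\<^sup>2" using ell unfolding g' lin_tr_aff by (intro power_strict_mono) auto
  moreover have "E = 4 * (a*d - b*c) - (a + d)\<^sup>2" by (simp add: E_def power2_eq_square algebra_simps)
  ultimately have E: "E > 0" using D by simp
  have c: "c \<noteq> 0" using E by (auto simp: E_def)
  define R where "R = 1 + (1 + 4 / E) * (\<bar>b\<bar> + \<bar>c\<bar> + \<bar>a - d\<bar>)"
  have "\<bar>x\<bar> \<le> R \<and> \<bar>y\<bar> \<le> R \<and> \<bar>z\<bar> \<le> R \<and> \<bar>w\<bar> \<le> R" if h: "aff x y z w p' q' \<in> H" for x y z w p' q'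
  proof -
    have xw: "x*w - y*z = 1" using lin_det_1[OF h] by simp
    define m where "m = b*z - y*c"
    define n where "n = y*(a - d) - b*(x - w)"
    define k where "k = c*(x - w) - z*(a - d)"
    have le: "m\<^sup>2 + n * k \<le> 0"
      using commutator_trace_le_2[OF g[unfolded g'] h] by (simp add: m_def n_def k_def)
    \<comment> \<open>The trace of \<open>M A\<close> vanishes.\<close>
    have rel: "n * c = - m * (a - d) - b * k" by (simp add: m_def n_def k_def algebra_simps)
    have "4 * c\<^sup>2 * (m\<^sup>2 + n * k) = 4 * (c * m)\<^sup>2 + 4 * c * k * (n * c)"
      by (simp add: power2_eq_square algebra_simps)
    also have "\<dots> = (2 * c * m - k * (a - d))\<^sup>2 + k\<^sup>2 * E"
      unfolding rel E_def by (simp add: power2_eq_square algebra_simps)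
    finally have "(2 * c * m - k * (a - d))\<^sup>2 + k\<^sup>2 * E = 4 * c\<^sup>2 * (m\<^sup>2 + n * k)" by simp
    also have "\<dots> \<le> 0" using le by (simp add: mult_nonneg_nonpos)
    finally have "(2 * c * m - k * (a - d))\<^sup>2 + k\<^sup>2 * E \<le> 0" .
    moreover have "0 \<le> (2 * c * m - k * (a - d))\<^sup>2" "0 \<le> k\<^sup>2 * E" using E by simp_all
    ultimately have "(2 * c * m - k * (a - d))\<^sup>2 = 0" "k\<^sup>2 * E = 0" by linarith+
    then have k0: "k = 0" and m0: "m = 0" using E c by auto
    \<comment> \<open>The coefficient of \<open>A\<close> when \<open>B\<close> is written in terms of \<open>1\<close> and \<open>A\<close>.\<close>
    define t where "t = z / c"
    have z: "z = t * c" using c by (simp add: t_def)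
    have y: "y = t * b" using m0 c by (simp add: m_def t_def field_simps)
    have xmw: "x - w = t * (a - d)" using k0 c by (simp add: k_def t_def field_simps)
    have tr: "\<bar>x + w\<bar> \<le> 2" using trace_le_2[OF h] by simp
    have "t\<^sup>2 * E = - ((x - w)\<^sup>2 + 4 * y * z)"
      unfolding xmw unfolding y z E_def by (simp add: power2_eq_square algebra_simps)
    also have "\<dots> = 4 * (x*w - y*z) - (x + w)\<^sup>2" by (simp add: power2_eq_square algebra_simps)
    also have "\<dots> \<le> 4" using xw by simp
    finally have "t\<^sup>2 \<le> 4 / E" using E by (simp add: field_simps)
    moreover have "\<bar>t\<bar> \<le> 1 + t\<^sup>2"
    proof -
      have "0 \<le> (\<bar>t\<bar> - 1)\<^sup>2" "(\<bar>t\<bar> - 1)\<^sup>2 = t\<^sup>2 - 2 * \<bar>t\<bar> + 1"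
        by (rule zero_le_power2) (simp add: power2_diff)
      then show ?thesis using abs_ge_zero[of t] by linarith
    qed
    ultimately have t: "\<bar>t\<bar> \<le> 1 + 4 / E" by linarith
    have prod: "\<bar>t * s\<bar> \<le> (1 + 4 / E) * \<bar>s\<bar>" for s
      unfolding abs_mult using t by (intro mult_right_mono) auto
    define B where "B = (1 + 4 / E) * \<bar>b\<bar>"
    define C where "C = (1 + 4 / E) * \<bar>c\<bar>"
    define F where "F = (1 + 4 / E) * \<bar>a - d\<bar>"
    have nn: "0 \<le> B" "0 \<le> C" "0 \<le> F" using E by (simp_all add: B_def C_def F_def)
    have R: "R = 1 + B + C + F" by (simp add: R_def B_def C_def F_def algebra_simps)
    have yz: "\<bar>y\<bar> \<le> B" "\<bar>z\<bar> \<le> C" "\<bar>x - w\<bar> \<le> F"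
      using prod[of b] prod[of c] prod[of "a - d"] by (simp_all add: y z xmw B_def C_def F_def)
    have "\<bar>x\<bar> \<le> 1 + F" "\<bar>w\<bar> \<le> 1 + F" using tr yz(3) nn(3) by linarith+
    then show ?thesis using nn yz(1,2) unfolding R by (intro conjI; linarith)
  qed
  then show ?thesis by (rule bounded_linear_part_imp_bounded)
qed

text \<open>Some linear part differs from \<open>1\<close> and \<open>-1\<close>, as otherwise all are bounded, and it is not
  elliptic. So its trace is \<open>2 * e\<close> with \<open>e\<close> a sign, and its square is unipotent.\<close>

lemma unbounded_imp_parabolic:
  assumes unb: "\<And>S. \<not> H \<subseteq> aff_box S"
  shows "\<exists>m n k p q. aff (1 + m) n k (1 - m) p q \<in> H \<and> m * m + n * k = 0 \<and> \<not> (m = 0 \<and> n = 0 \<and> k = 0)"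
proof -
  obtain a b c d p q where h: "aff a b c d p q \<in> H" (is "?h \<in> H")
    and big: "\<not> (\<bar>a\<bar> \<le> 1 \<and> \<bar>b\<bar> \<le> 1 \<and> \<bar>c\<bar> \<le> 1 \<and> \<bar>d\<bar> \<le> 1)"
    using bounded_linear_part_imp_bounded[of 1] unb by metis
  have D: "a*d - b*c = 1" using lin_det_1[OF h] by simp
  have "\<not> \<bar>a + d\<bar> < 2" using elliptic_imp_bounded[OF h] unb by auto
  then have "\<bar>a + d\<bar> = 2" using trace_le_2[OF h] by simp
  then obtain e where e: "e = 1 \<or> e = -1" and tr: "a + d = 2 * e"
    by (metis abs_eq_iff abs_numeral mult.right_neutral mult_minus1_right)
  define m where "m = (a - d) * e"
  have ee: "e * e = 1" using e by auto
  have me: "m * e = a - d" using ee by (simp add: m_def mult.assoc)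
  have a: "a = e + m * e / 2" and d: "d = e - m * e / 2"
    using tr me by linarith+
  have "m * m + (2 * e * b) * (2 * e * c) = (e * e) * ((a + d)\<^sup>2 - 4 * (a*d - b*c))"
    by (simp add: m_def power2_eq_square algebra_simps)
  also have "\<dots> = 0" unfolding D tr by (simp add: power2_eq_square ee)
  finally have nil: "m * m + (2 * e * b) * (2 * e * c) = 0" .
  have "?h ** ?h \<in> H" using h mult_mem by blast
  moreover have "a * a + b * c = 1 + m" "a * b + b * d = 2 * e * b" "c * a + d * c = 2 * e * c" "c * b + d * d = 1 - m"
  proof -
    have "a * (2 * e) = 2 * (e * e) + m * (e * e)" "d * (2 * e) = 2 * (e * e) - m * (e * e)"
      unfolding a d by (simp_all add: algebra_simps)
    then have ea: "a * (2 * e) = 2 + m" "d * (2 * e) = 2 - m" unfolding ee by simp_all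
    have "a * a + b * c = a * (a + d) - (a*d - b*c)" by (simp add: algebra_simps)
    also have "\<dots> = 1 + m" unfolding D tr ea by simp
    finally show "a * a + b * c = 1 + m" .
    have "c * b + d * d = d * (a + d) - (a*d - b*c)" by (simp add: algebra_simps)
    also have "\<dots> = 1 - m" unfolding D tr ea by simp
    finally show "c * b + d * d = 1 - m" .
    have "a * b + b * d = b * (a + d)" "c * a + d * c = c * (a + d)" by (simp_all add: algebra_simps)
    then show "a * b + b * d = 2 * e * b" "c * a + d * c = 2 * e * c" unfolding tr by simp_all
  qed
  ultimately have "aff (1 + m) (2 * e * b) (2 * e * c) (1 - m) (a * p + b * q + p) (c * p + d * q + q) \<in> H"
    by (simp add: aff_mult)
  moreover have "\<not> (m = 0 \<and> 2 * e * b = 0 \<and> 2 * e * c = 0)"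
  proof
    assume "m = 0 \<and> 2 * e * b = 0 \<and> 2 * e * c = 0"
    then have "b = 0" "c = 0" "a = e" "d = e" using e a d by auto
    with big e show False by auto
  qed
  ultimately show ?thesis using nil by blast
qed

text \<open>Let \<open>M\<close> be the nilpotent part of the linear map and \<open>v = (p, q)\<close>. In the frame
  \<open>f\<^sub>2 = M v\<close>, \<open>f\<^sub>1 = v - f\<^sub>2 / 2\<close> the affine map is the standard one: \<open>M f\<^sub>1 = f\<^sub>2\<close>, \<open>M f\<^sub>2 = 0\<close> and
  \<open>v = f\<^sub>1 + f\<^sub>2 / 2\<close>. The vectors \<open>v\<close> and \<open>M v\<close> are dependent only if \<open>v\<close> lies in the kernel of \<open>M\<close>,
  which is also its image; then there would be a fixed point.\<close>

lemma parabolic_conj_screw: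
  assumes h: "aff (1 + m) n k (1 - m) p q \<in> H" and nil: "m * m + n * k = 0"
    and nz: "\<not> (m = 0 \<and> n = 0 \<and> k = 0)"
  shows "\<exists>g\<in>carrier aff_group. aff (1 + m) n k (1 - m) p q ** g = g ** screw 1"
proof -
  define f1 where "f1 = m * p + n * q"
  define f2 where "f2 = k * p - m * q"
  have Mf: "m * f1 + n * f2 = 0" "k * f1 - m * f2 = 0"
  proof -
    have "m * f1 + n * f2 = (m * m + n * k) * p" "k * f1 - m * f2 = (m * m + n * k) * q"
      by (simp_all add: f1_def f2_def algebra_simps)
    then show "m * f1 + n * f2 = 0" "k * f1 - m * f2 = 0" using nil by simp_all
  qed
  have det: "p * f2 - q * f1 \<noteq> 0"
  proof
    assume z: "p * f2 - q * f1 = 0"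
    have "\<exists>x y. (1 + m) * x + n * y + p = x \<and> k * x + (1 - m) * y + q = y"
    proof (cases "k = 0")
      case False
      have "(k * p - m * q)\<^sup>2 = k * (p * f2 - q * f1) + (m * m + n * k) * q * q"
        by (simp add: f1_def f2_def power2_eq_square algebra_simps)
      then have "k * p = m * q" using z nil by simp
      then show ?thesis using False
        by (intro exI[of _ "- q / k"] exI[of _ 0]) (simp add: field_simps)
    next
      case True
      then have m: "m = 0" using nil by simp
      then have n: "n \<noteq> 0" using nz True by simp
      then have "q = 0" using z by (simp add: f1_def f2_def True m)
      then show ?thesis using n by (intro exI[of _ 0] exI[of _ "- p / n"]) (simp add: True m)
    qed
    then show False using unipotent_fixed_point_trivial[OF h _ nil] nz by auto
  qed
  define g where "g = aff (p - f1 / 2) f1 (q - f2 / 2) f2 0 0"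
  have "(p - f1 / 2) * f2 - f1 * (q - f2 / 2) = p * f2 - q * f1" by (simp add: algebra_simps)
  then have "g \<in> carrier aff_group" using det by (simp add: g_def)
  moreover have "aff (1 + m) n k (1 - m) p q ** g = g ** aff 1 0 1 1 1 (1/2)"
    unfolding g_def aff_mult aff_eq_iff
  proof (intro conjI)
    have "(1 + m) * (p - f1/2) + n * (q - f2/2) = (p - f1/2) + (m * p + n * q) - (m * f1 + n * f2) / 2"
      by (simp add: field_simps)
    then show "(1 + m) * (p - f1/2) + n * (q - f2/2) = (p - f1/2) * 1 + f1 * 1"
      unfolding Mf f1_def[symmetric] by simp
    have "k * (p - f1/2) + (1 - m) * (q - f2/2) = (q - f2/2) + (k * p - m * q) - (k * f1 - m * f2) / 2"
      by (simp add: field_simps)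
    then show "k * (p - f1/2) + (1 - m) * (q - f2/2) = (q - f2/2) * 1 + f2 * 1"
      unfolding Mf f2_def[symmetric] by simp
  qed (use Mf in \<open>simp_all add: algebra_simps\<close>)
  ultimately show ?thesis by (auto simp: screw_def)
qed

section \<open>Subgroups containing the standard screw motion\<close>

lemma conj_thin_subgroup:
  assumes g: "g \<in> carrier aff_group"
  shows "thin_subgroup L ((\<lambda>h. inv\<^bsub>aff_group\<^esub> g ** h ** g) ` H)"
proof (rule thin_subgroup.intro)
  let ?i = "inv\<^bsub>aff_group\<^esub> g" and ?H = "(\<lambda>h. inv\<^bsub>aff_group\<^esub> g ** h ** g) ` H"
  note ig = inv_carrier[OF g]
  show "L = L_B1 \<or> L = L_D1" by (rule L)
  have mult: "(?i ** h ** g) ** (?i ** h' ** g) = ?i ** (h ** h') ** g" for h h'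
  proof -
    have "(?i ** h ** g) ** (?i ** h' ** g) = ?i ** h ** (g ** ?i) ** h' ** g"
      by (simp add: matrix_mul_assoc)
    then show ?thesis using ig by (simp add: matrix_mul_assoc)
  qed
  show "subgroup ?H aff_group"
  proof (rule group.subgroupI[OF group_aff_group])
    show "?H \<subseteq> carrier aff_group" using g ig in_carrier by (auto intro!: carrier_mult)
    show "?H \<noteq> {}" using one_mem by blast
    show "inv\<^bsub>aff_group\<^esub> x \<in> ?H" if xH: "x \<in> ?H" for x
    proof -
      obtain h where h: "h \<in> H" and x: "x = ?i ** h ** g" using xH by blast
      have "inv\<^bsub>aff_group\<^esub> x = ?i ** inv\<^bsub>aff_group\<^esub> h ** g"
        unfolding x
      proof (rule group.inv_equality[OF group_aff_group])
        show "(?i ** inv\<^bsub>aff_group\<^esub> h ** g) \<otimes>\<^bsub>aff_group\<^esub> (?i ** h ** g) = \<one>\<^bsub>aff_group\<^esub>"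
          using mult[of "inv\<^bsub>aff_group\<^esub> h" h] inv_carrier[OF in_carrier[OF h]] ig by simp
      qed (use g ig h in_carrier inv_carrier in \<open>auto intro!: carrier_mult\<close>)
      then show ?thesis using inv_mem[OF h] by blast
    qed
    show "x \<otimes>\<^bsub>aff_group\<^esub> y \<in> ?H" if "x \<in> ?H" "y \<in> ?H" for x y
      using that mult mult_mem by (auto intro!: imageI)
  qed
  show "connected ?H"
    using conn unfolding matrix_matrix_mult_def
    by (intro connected_continuous_image continuous_intros) auto
  have "compactin aff_top {g, ?i}" using g ig by (simp add: compactin_aff_top)
  then obtain r where r: "g \<in> aff_box r" "?i \<in> aff_box r"
    using compact_subset_aff_box by (metis insert_subset)
  show "thin L ?H" unfolding thin_def
  proof
    fix R :: real
    obtain S where S: "\<And>h. h \<in> H \<Longrightarrow> h \<in> near L (3 * r * R) \<Longrightarrow> h \<in> aff_box S" using near_bounded[of "3 * r * R"] by blast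
    have "x \<in> aff_box (3 * (3 * r * S) * r)" if x: "x \<in> ?H" "x \<in> near L R" for x
    proof -
      obtain h where h: "h \<in> H" and x': "x = ?i ** h ** g" using x(1) by blast
      have "h \<in> near L (3 * r * R)"
        using near_shift[OF r(2,1) in_carrier[OF h]] x(2) x' by simp
      then have "h \<in> aff_box S" using S h by blast
      then show ?thesis unfolding x' using r by (intro aff_box_mult)
    qed
    then show "\<exists>S. ?H \<inter> near L R \<subseteq> aff_box S" by blast
  qed
qed


text \<open>Multiplying by \<open>screw (2 ^ i)\<close> adds \<open>2 ^ i * b\<close> to the trace, so \<open>b = 0\<close>. The diagonal is then
  \<open>(1, 1)\<close> or \<open>(-1, -1)\<close>, and connectedness of \<open>H\<close> excludes the latter.\<close>

lemma contains_screw_imp_unipotent: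
  assumes screw: "screw 1 \<in> H" and h: "aff a b c d p q \<in> H"
  shows "a = 1 \<and> b = 0 \<and> d = 1"
proof -
  have lower: "b = 0 \<and> d = a \<and> a * a = 1" if h: "aff a b c d p q \<in> H" for a b c d p q
  proof -
    have D: "a * d - b * c = 1" and tr: "\<bar>a + d\<bar> \<le> 2"
      using lin_det_1[OF h] trace_le_2[OF h] by simp_all
    have "2^i * \<bar>b\<bar> \<le> 2 + \<bar>a + d\<bar>" for i
    proof -
      have "screw (2^i) \<in> H" using squares_mem[OF screw, of i] by (simp add: squares_screw)
      from trace_le_2[OF mult_mem[OF this h]] have "\<bar>a + (2^i * b + d)\<bar> \<le> 2"
        by (simp add: screw_def aff_mult)
      then have "\<bar>2^i * b\<bar> \<le> 2 + \<bar>a + d\<bar>" by linarith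
      then show ?thesis by (simp add: abs_mult)
    qed
    then have b: "b = 0" by (rule two_power_bounded_imp_zero)
    have "(a - d)\<^sup>2 = \<bar>a + d\<bar>\<^sup>2 - 4" using D b by (simp add: power2_eq_square algebra_simps)
    moreover have "\<bar>a + d\<bar>\<^sup>2 \<le> 2\<^sup>2" using tr by (intro power_mono) auto
    ultimately have "(a - d)\<^sup>2 \<le> 0" by simp
    then have "d = a" by simp
    then show ?thesis using b D by simp
  qed
  have "a \<noteq> -1"
  proof
    assume "a = -1"
    have "connected ((\<lambda>h. h$1$1) ` H)"
      using conn by (intro connected_continuous_image continuous_intros)
    moreover have "-1 \<in> (\<lambda>h. h$1$1) ` H" using imageI[OF h, of "\<lambda>h. h$1$1"] \<open>a = -1\<close> by simp
    moreover have "1 \<in> (\<lambda>h. h$1$1) ` H" using imageI[OF screw, of "\<lambda>h. h$1$1"] by (simp add: screw_def)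
    ultimately have "{-1..1} \<subseteq> (\<lambda>h. h$1$1) ` H" by (intro connected_contains_Icc)
    then have "0 \<in> (\<lambda>h. h$1$1) ` H" by (auto simp: subset_iff)
    then obtain g where g: "g \<in> H" "g$1$1 = 0" by auto
    then obtain a' b' c' d' p' q' where "g = aff a' b' c' d' p' q'"
      using in_carrier[OF g(1)] by (auto simp: carrier_iff_aff)
    then show False using lower g by fastforce
  qed
  then show ?thesis using lower[OF h] by (auto simp: square_eq_1_iff)
qed

lemma determined_by_shear:
  assumes "aff 1 0 s 1 p q \<in> H" "aff 1 0 s 1 p' q' \<in> H"
  shows "p = p' \<and> q = q'"
proof -
  have "aff 1 0 s 1 p q ** inv\<^bsub>aff_group\<^esub> aff 1 0 s 1 p' q' = aff 1 0 0 1 (p - p') (q - q')"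
    by (simp add: inv_aff aff_mult)
  then have "aff 1 0 0 1 (p - p') (q - q') \<in> H" using mult_mem[OF assms(1) inv_mem[OF assms(2)]] by simp
  then show ?thesis using translation_trivial by fastforce
qed

text \<open>The products with \<open>screw 1\<close> in both orders have the same linear part, so they agree.\<close>

lemma contains_screw_form:
  assumes screw: "screw 1 \<in> H" and h: "h \<in> H"
  obtains s q where "h = aff 1 0 s 1 s q"
proof -
  obtain a b s d p q where "h = aff a b s d p q"
    using in_carrier[OF h] by (auto simp: carrier_iff_aff)
  with contains_screw_imp_unipotent[OF screw] h have h': "h = aff 1 0 s 1 p q" by blast
  have "screw 1 ** h \<in> H" "h ** screw 1 \<in> H" using screw h mult_mem by auto
  then have "aff 1 0 (s + 1) 1 (p + 1) (p + q + 1/2) \<in> H" "aff 1 0 (s + 1) 1 (p + 1) (s + 1/2 + q) \<in> H"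
    by (simp_all add: h' screw_def aff_mult add.commute add.left_commute)
  from determined_by_shear[OF this] have "p = s" by simp
  then show ?thesis using h' that by blast
qed

lemma contains_screw_shear_surj:
  assumes screw: "screw 1 \<in> H"
  obtains q where "aff 1 0 s 1 s q \<in> H"
proof -
  obtain i where i: "\<bar>s\<bar> < 2^i" using real_arch_pow[of 2 "\<bar>s\<bar>"] by auto
  have "screw (2^i) \<in> H" using squares_mem[OF screw, of i] by (simp add: squares_screw)
  moreover from inv_mem[OF this] have "screw (- (2^i)) \<in> H" by (simp add: inv_screw)
  ultimately have "2^i \<in> (\<lambda>h. h$2$1) ` H" "- (2^i) \<in> (\<lambda>h. h$2$1) ` H"
    using imageI[of "screw (2^i)" H "\<lambda>h. h$2$1"] imageI[of "screw (- (2^i))" H "\<lambda>h. h$2$1"]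
    by (simp_all add: screw_def)
  moreover have "connected ((\<lambda>h. h$2$1) ` H)"
    using conn by (intro connected_continuous_image continuous_intros)
  ultimately have "{- (2^i)..2^i} \<subseteq> (\<lambda>h. h$2$1) ` H" by (intro connected_contains_Icc)
  then have "s \<in> (\<lambda>h. h$2$1) ` H"
    by (rule subsetD) (use i in \<open>simp add: abs_less_iff\<close>)
  then obtain h where h: "h \<in> H" "s = h$2$1" by blast
  obtain s' q where "h = aff 1 0 s' 1 s' q" using contains_screw_form[OF screw h(1)] .
  then show ?thesis using h that by simp
qed

text \<open>The square of an element with shear \<open>t\<close> has shear \<open>2 * t\<close> and is therefore \<open>screw (2 * t)\<close> if
  that lies in \<open>H\<close>; this determines the element to be \<open>screw t\<close>. So \<open>screw 1\<close> can be halved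
  repeatedly.\<close>

lemma contains_screw_imp_dyadic:
  assumes screw: "screw 1 \<in> H"
  shows "screw (of_int j * (1/2)^k) \<in> H"
proof -
  have unit: "screw ((1/2)^k) \<in> H" for k
  proof (induction k)
    case (Suc k)
    define t :: real where "t = (1/2)^(Suc k)"
    obtain q where q: "aff 1 0 t 1 t q \<in> H" using contains_screw_shear_surj[OF screw] .
    have "aff 1 0 t 1 t q ** aff 1 0 t 1 t q = aff 1 0 (2*t) 1 (2*t) (t * t + 2 * q)"
      by (simp add: aff_mult)
    then have "aff 1 0 (2*t) 1 (2*t) (t * t + 2 * q) \<in> H" using mult_mem[OF q q] by simp
    moreover have "aff 1 0 (2*t) 1 (2*t) ((2*t)\<^sup>2 / 2) \<in> H"
      using Suc by (simp add: screw_def t_def)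
    ultimately have "t * t + 2 * q = (2*t)\<^sup>2 / 2" using determined_by_shear by blast
    then have "q = t\<^sup>2 / 2" by (simp add: power2_eq_square)
    then have "screw t \<in> H" using q by (simp only: screw_def)
    then show ?case by (simp only: t_def)
  qed (use screw in simp)
  have nat: "screw (of_nat n * (1/2)^k) \<in> H" for n
  proof (induction n)
    case 0
    show ?case using one_mem by (simp add: screw_def aff_one)
  next
    case (Suc n)
    have "of_nat (Suc n) * (1/2)^k = of_nat n * (1/2)^k + (1/2::real)^k" by (simp add: algebra_simps)
    then show ?case using mult_mem[OF Suc unit[of k]] by (simp only: screw_add)
  qed
  show ?thesis
  proof (cases j)
    case (nonneg n)
    then show ?thesis using nat[of n] by simp
  next
    case (neg n)
    have "screw (- (of_nat (Suc n) * (1/2)^k)) \<in> H"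
      using inv_mem[OF nat[of "Suc n"]] by (simp only: inv_screw)
    moreover have "of_int j * (1/2)^k = - (of_nat (Suc n) * (1/2::real)^k)"
      unfolding neg by (simp only: of_int_minus of_int_of_nat_eq mult_minus_left)
    ultimately show ?thesis by simp
  qed
qed

lemma contains_screw_imp_eq_N_parab:
  assumes screw: "screw 1 \<in> H" and cl: "closedin aff_top H"
  shows "H = N_parab"
proof -
  obtain T where T: "closed T" "H = carrier aff_group \<inter> T"
    using cl by (auto simp: aff_top_def closedin_closed)
  have all: "screw x \<in> H" for x
  proof -
    \<comment> \<open>Dyadic approximations of \<open>x\<close>; closedness of \<open>H\<close> takes care of the limit.\<close>
    define a where "a k = of_int \<lfloor>x * 2^k\<rfloor> * (1/2::real)^k" for k
    have "\<bar>a k - x\<bar> \<le> (1/2)^k" for k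
    proof -
      have "x = x * 2^k * (1/2)^k" by (simp add: power_one_over)
      then have "a k - x = (of_int \<lfloor>x * 2^k\<rfloor> - x * 2^k) * (1/2)^k"
        unfolding a_def left_diff_distrib by linarith
      then have "\<bar>a k - x\<bar> = \<bar>of_int \<lfloor>x * 2^k\<rfloor> - x * 2^k\<bar> * (1/2)^k" by (simp add: abs_mult)
      also have "\<dots> \<le> 1 * (1/2)^k" by (intro mult_right_mono, linarith, simp)
      finally show ?thesis by simp
    qed
    then have "\<forall>\<^sub>F k in sequentially. norm (a k - x) \<le> (1/2)^k" by simp
    moreover have "(\<lambda>k. (1/2::real)^k) \<longlonglongrightarrow> 0" by (intro LIMSEQ_power_zero) simp
    ultimately have "(\<lambda>k. a k - x) \<longlonglongrightarrow> 0" by (rule Lim_null_comparison)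
    then have "a \<longlonglongrightarrow> x" by (simp add: LIM_zero_iff)
    then have "(\<lambda>k. screw (a k)) \<longlonglongrightarrow> screw x" by (rule tendsto_screw)
    moreover have "screw (a k) \<in> T" for k
      using contains_screw_imp_dyadic[OF screw] T(2) unfolding a_def by blast
    ultimately have "screw x \<in> T" using closed_sequentially[OF T(1)] by metis
    then show ?thesis using T by (simp add: screw_def)
  qed
  have "h \<in> N_parab" if h: "h \<in> H" for h
  proof -
    obtain s q where h': "h = aff 1 0 s 1 s q" using contains_screw_form[OF screw h] .
    have "q = s\<^sup>2 / 2" using determined_by_shear[of s s q s "s\<^sup>2/2"] h all[of s] by (simp add: h' screw_def)
    then show ?thesis by (auto simp: h' N_parab_eq screw_def)
  qed
  moreover have "N_parab \<subseteq> H" using all by (auto simp: N_parab_eq)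
  ultimately show ?thesis by blast
qed

end

section \<open>Conjugation and the classification\<close>

lemma closedin_conj:
  assumes g: "g \<in> carrier aff_group" and cl: "closedin aff_top H"
  shows "closedin aff_top ((\<lambda>h. inv\<^bsub>aff_group\<^esub> g ** h ** g) ` H)"
proof -
  let ?i = "inv\<^bsub>aff_group\<^esub> g"
  note ig = inv_carrier[OF g]
  obtain T where T: "closed T" "H = carrier aff_group \<inter> T"
    using cl by (auto simp: aff_top_def closedin_closed)
  have "continuous_on UNIV (\<lambda>x. g ** x ** ?i)"
    unfolding matrix_matrix_mult_def by (intro continuous_intros)
  then have "closed ((\<lambda>x. g ** x ** ?i) -` T)" using T(1) by (simp add: closed_vimage)
  moreover have "(\<lambda>h. ?i ** h ** g) ` H = carrier aff_group \<inter> ((\<lambda>x. g ** x ** ?i) -` T)"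
  proof -
    have 1: "g ** (?i ** h ** g) ** ?i = h" for h
    proof -
      have "g ** (?i ** h ** g) ** ?i = (g ** ?i) ** h ** (g ** ?i)" by (simp add: matrix_mul_assoc)
      then show ?thesis using ig by simp
    qed
    have 2: "?i ** (g ** x ** ?i) ** g = x" for x
    proof -
      have "?i ** (g ** x ** ?i) ** g = (?i ** g) ** x ** (?i ** g)" by (simp add: matrix_mul_assoc)
      then show ?thesis using ig by simp
    qed
    show ?thesis
    proof (intro equalityI subsetI)
      fix x assume "x \<in> (\<lambda>h. ?i ** h ** g) ` H"
      then show "x \<in> carrier aff_group \<inter> ((\<lambda>x. g ** x ** ?i) -` T)"
        using T g ig 1 by (auto intro!: carrier_mult)
    next
      fix x assume "x \<in> carrier aff_group \<inter> ((\<lambda>x. g ** x ** ?i) -` T)"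
      then have "g ** x ** ?i \<in> H" using T g ig by (auto intro!: carrier_mult)
      then show "x \<in> (\<lambda>h. ?i ** h ** g) ` H" using 2[of x] by (metis imageI)
    qed
  qed
  ultimately show ?thesis by (auto simp: aff_top_def closedin_closed)
qed

lemma similar_pair_conj:
  assumes g: "g \<in> carrier aff_group" and H: "H \<subseteq> carrier aff_group"
  shows "similar_pair aff_group aff_top H ((\<lambda>h. inv\<^bsub>aff_group\<^esub> g ** h ** g) ` H)"
proof -
  let ?i = "inv\<^bsub>aff_group\<^esub> g"
  note ig = inv_carrier[OF g]
  have ii: "inv\<^bsub>aff_group\<^esub> ?i = g" using group.inv_inv[OF group_aff_group g] .
  have eq: "h = g ** (?i ** h ** g) ** ?i" for h
  proof -
    have "g ** (?i ** h ** g) ** ?i = (g ** ?i) ** h ** (g ** ?i)" by (simp add: matrix_mul_assoc)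
    then show ?thesis using ig by simp
  qed
  have "compactin aff_top {g, ?i}" using g ig by (simp add: compactin_aff_top)
  moreover have "H \<subseteq> translates aff_group {g, ?i} ((\<lambda>h. ?i ** h ** g) ` H)"
  proof
    fix h assume "h \<in> H"
    then show "h \<in> translates aff_group {g, ?i} ((\<lambda>h. ?i ** h ** g) ` H)"
      unfolding translates_def mem_Collect_eq using eq[of h]
      by (intro exI[of _ g] exI[of _ "?i ** h ** g"]) auto
  qed
  moreover have "(\<lambda>h. ?i ** h ** g) ` H \<subseteq> translates aff_group {g, ?i} H"
  proof
    fix x assume "x \<in> (\<lambda>h. ?i ** h ** g) ` H"
    then obtain h where "h \<in> H" "x = ?i ** h ** g" by blast
    then show "x \<in> translates aff_group {g, ?i} H"
      unfolding translates_def mem_Collect_eq using ii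
      by (intro exI[of _ ?i] exI[of _ h]) auto
  qed
  ultimately show ?thesis unfolding similar_pair_def by blast
qed

theorem theorem1p4:
  fixes L H :: "(real^3^3) set"
  assumes "L = L_B1 \<or> L = L_D1"
    and "subgroup H aff_group"
    and "closedin aff_top H"
    and "connectedin aff_top H"
    and "\<not> compactin aff_top H"
    and "proper_pair aff_group aff_top L H"
  shows "L = L_D1 \<and> similar_pair aff_group aff_top H N_parab"
proof -
  have H: "H \<subseteq> carrier aff_group" using assms(2) by (simp add: subgroup.subset)
  have "L \<subseteq> carrier aff_group" using assms(1) L_subset_carrier by auto
  then have "thin L H" using proper_pair_imp_thin assms(6) H by blast
  moreover have "connected H"
    using assms(4) by (simp add: aff_top_def connectedin_subtopology)
  ultimately interpret thin_subgroup L H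
    using assms(1,2) by (intro thin_subgroup.intro)
  have unb: "\<not> H \<subseteq> aff_box S" for S
  proof
    assume S: "H \<subseteq> aff_box S"
    obtain T where T: "closed T" "H = carrier aff_group \<inter> T"
      using assms(3) by (auto simp: aff_top_def closedin_closed)
    have "H = aff_box S \<inter> T" using T S aff_box_carrier by auto
    then have "compact H" using compact_aff_box T(1) by (simp add: compact_Int_closed)
    then show False using assms(5) H by (simp add: compactin_aff_top)
  qed
  obtain m n k p q where h: "aff (1 + m) n k (1 - m) p q \<in> H" and nil: "m * m + n * k = 0"
    and nz: "\<not> (m = 0 \<and> n = 0 \<and> k = 0)"
    using unbounded_imp_parabolic[OF unb] by blast
  obtain g where g: "g \<in> carrier aff_group"
    and conj: "aff (1 + m) n k (1 - m) p q ** g = g ** screw 1"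
    using parabolic_conj_screw[OF h nil nz] by blast
  define H' where "H' = (\<lambda>h. inv\<^bsub>aff_group\<^esub> g ** h ** g) ` H"
  interpret H': thin_subgroup L H' unfolding H'_def using g by (rule conj_thin_subgroup)
  have "inv\<^bsub>aff_group\<^esub> g ** aff (1 + m) n k (1 - m) p q ** g = inv\<^bsub>aff_group\<^esub> g ** (g ** screw 1)"
    by (simp add: conj flip: matrix_mul_assoc)
  also have "\<dots> = screw 1" using inv_carrier[OF g] by (simp add: matrix_mul_assoc)
  finally have "screw 1 \<in> H'" using h unfolding H'_def by (metis imageI)
  then have N: "H' = N_parab"
    using closedin_conj[OF g assms(3)] unfolding H'_def[symmetric] by (rule H'.contains_screw_imp_eq_N_parab)
  have "L \<noteq> L_B1" using H'.thin not_thin_L_B1_N_parab unfolding N by auto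
  moreover have "similar_pair aff_group aff_top H N_parab"
    using similar_pair_conj[OF g H] unfolding H'_def[symmetric] N .
  ultimately show ?thesis using assms(1) by blast
qed

end
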